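(* The intersection-emptiness problem for deterministic strong reset Parikh automata (given two deterministic strong reset Parikh automata $\mathcal{A}_1,\mathcal{A}_2$ over the same alphabet, is $SR_\omega(\mathcal{A}_1)\cap SR_\omega(\mathcal{A}_2)=\varnothing$?) is undecidable.
   Context: $\mathbb{N}=\{0,1,2,\dots\}$. A linear set is a set $C(\mathbf{b},P)=\{\mathbf{b}+\mathbf{p}_1z_1+\dots+\mathbf{p}_\ell z_\ell \mid z_1,\dots,z_\ell\in\mathbb{N}\}\subseteq\mathbb{N}^d$ with $\mathbf{b}\in\mathbb{N}^d$ and $P=\{\mathbf{p}_1,\dots,\mathbf{p}_\ell\}\subseteq\mathbb{N}^d$ finite ($\ell\ge 0$); a semi-linear set is a finite union of linear sets, given explicitly by base and period vectors. A Parikh automaton (PA) of dimension $d\ge 1$ is a tuple $\mathcal{A}=(Q,\Sigma,q_0,\Delta,F,C)$ with a finite state set $Q$, a finite non-empty alphabet $\Sigma$, an initial state $q_0\in Q$, a finite set of labeled transitions $\Delta\subseteq Q\times\Sigma\times\mathbb{N}^d\times Q$, a set of accepting states $F\subseteq Q$, and a semi-linear set $C\subseteq\mathbb{N}^d$. It is deterministic if for every $(p,a)\in Q\times\Sigma$ there is exactly one transition $(p,a,\mathbf{v},q)\in\Delta$. A run on $\alpha=\alpha_1\alpha_2\dots\in\Sigma^\omega$ is an infinite sequence $r=r_1r_2\dots$ with $r_i=(p_{i-1},\alpha_i,\mathbf{v}_i,p_i)\in\Delta$ and $p_0=q_0$; write $\rho(r_m\dots r_n)=\sum_{i=m}^n\mathbf{v}_i$.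 A strong reset PA is a PA with the following acceptance: let $k_0=0$ and let $k_1<k_2<\dots$ be all positions $k\ge 1$ with $p_k\in F$; then $r$ is accepting iff this sequence is infinite and $\rho(r_{k_{i-1}+1}\dots r_{k_i})\in C$ for all $i\ge 1$. $SR_\omega(\mathcal{A})$ is the set of all $\alpha\in\Sigma^\omega$ on which there is an accepting run. *)

theory Defs
  imports Main "HOL-Library.Infinite_Set" "HOL-Library.Nat_Bijection" "HOL-Library.Omega_Words_Fun"
begin

section \<open>Linear and semi-linear sets\<close>

text \<open>Vectors in $\mathbb{N}^d$ are lists of naturals of length $d$.\<close>

definition vectors :: "nat \<Rightarrow> nat list set" where
  "vectors d = {v. length v = d}"

definition vec_sum :: "nat \<Rightarrow> nat list list \<Rightarrow> nat list" where
  "vec_sum d vs = map (\<lambda>j. \<Sum>v\<leftarrow>vs. v ! j) [0..<d]"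

definition linear_set :: "nat \<Rightarrow> nat list \<Rightarrow> nat list set \<Rightarrow> nat list set" where
  "linear_set d b P = {map (\<lambda>j. b ! j + (\<Sum>p\<in>P. p ! j * z p)) [0..<d] | z. True}"

definition semilinear :: "nat \<Rightarrow> nat list set \<Rightarrow> bool" where
  "semilinear d C \<longleftrightarrow>
     (\<exists>L. finite L \<and>
          (\<forall>(b, P)\<in>L. b \<in> vectors d \<and> finite P \<and> P \<subseteq> vectors d) \<and>
          C = (\<Union>(b, P)\<in>L. linear_set d b P))"


section \<open>Parikh automata and strong reset acceptance\<close>

type_synonym ('q, 'a) transition = "'q \<times> 'a \<times> nat list \<times> 'q"

fun source :: "('q, 'a) transition \<Rightarrow> 'q" where "source (p, a, v, q) = p"
fun letter :: "('q, 'a) transition \<Rightarrow> 'a" where "letter (p, a, v, q) = a"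
fun weight :: "('q, 'a) transition \<Rightarrow> nat list" where "weight (p, a, v, q) = v"
fun dest :: "('q, 'a) transition \<Rightarrow> 'q" where "dest (p, a, v, q) = q"

record ('q, 'a) pa =
  dimension :: nat
  states :: "'q set"
  alphabet :: "'a set"
  initial :: 'q
  transitions :: "('q, 'a) transition set"
  accepting :: "'q set"
  target :: "nat list set"

definition parikh_automaton :: "('q, 'a) pa \<Rightarrow> bool" where
  "parikh_automaton A \<longleftrightarrow>
     dimension A \<ge> 1 \<and>
     finite (states A) \<and>
     finite (alphabet A) \<and> alphabet A \<noteq> {} \<and>
     initial A \<in> states A \<and>
     finite (transitions A) \<and>
     transitions A \<subseteq> states A \<times> alphabet A \<times> vectors (dimension A) \<times> states A \<and>
     accepting A \<subseteq> states A \<and>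
     semilinear (dimension A) (target A)"

definition deterministic :: "('q, 'a) pa \<Rightarrow> bool" where
  "deterministic A \<longleftrightarrow>
     (\<forall>p\<in>states A. \<forall>a\<in>alphabet A. \<exists>!vq. (p, a, vq) \<in> transitions A)"

text \<open>Words and runs are indexed from $0$: the letter $\alpha_i$ is \<open>w (i - 1)\<close>, the
  transition $r_i$ is \<open>r (i - 1)\<close>, and hence the state $p_k$, for $k \geq 1$, is
  \<open>dest (r (k - 1))\<close>.\<close>

definition is_run :: "('q, 'a) pa \<Rightarrow> 'a word \<Rightarrow> ('q, 'a) transition word \<Rightarrow> bool" where
  "is_run A w r \<longleftrightarrow>
     (\<forall>i. r i \<in> transitions A \<and> letter (r i) = w i) \<and>
     source (r 0) = initial A \<and>
     (\<forall>i. source (r (Suc i)) = dest (r i))"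

definition hits :: "('q, 'a) pa \<Rightarrow> ('q, 'a) transition word \<Rightarrow> nat set" where
  "hits A r = {k. k \<ge> 1 \<and> dest (r (k - 1)) \<in> accepting A}"

text \<open>The sequence $0 = k_0 < k_1 < k_2 < \dots$; meaningful only if \<open>hits A r\<close> is infinite.\<close>

definition reset_pos :: "('q, 'a) pa \<Rightarrow> ('q, 'a) transition word \<Rightarrow> nat \<Rightarrow> nat" where
  "reset_pos A r = enumerate (insert 0 (hits A r))"

text \<open>With the index shift, $r_{k_{i-1}+1} \dots r_{k_i}$ is the half-open segment of \<open>r\<close>
  from position $k_{i-1}$ to position $k_i$.\<close>

definition strong_reset_accepting ::
    "('q, 'a) pa \<Rightarrow> ('q, 'a) transition word \<Rightarrow> bool" where
  "strong_reset_accepting A r \<longleftrightarrow>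
     infinite (hits A r) \<and>
     (\<forall>i\<ge>1. vec_sum (dimension A)
               (map weight (r [reset_pos A r (i - 1) \<rightarrow> reset_pos A r i])) \<in> target A)"

definition SR :: "('q, 'a) pa \<Rightarrow> 'a word set" where
  "SR A = {w. (\<forall>i. w i \<in> alphabet A) \<and> (\<exists>r. is_run A w r \<and> strong_reset_accepting A r)}"


section \<open>Finite descriptions of Parikh automata and their codes\<close>

text \<open>Problem instances are finite descriptions: states and letters are naturals, finite sets
  are given by lists (order and repetitions are irrelevant), and the semi-linear set is given by
  its base and period vectors.\<close>

record pa_desc =
  desc_dimension :: nat
  desc_states :: "nat list"
  desc_alphabet :: "nat list"
  desc_initial :: nat
  desc_transitions :: "(nat, nat) transition list"
  desc_accepting :: "nat list"
  desc_target :: "(nat list \<times> nat list list) list"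

definition pa_of :: "pa_desc \<Rightarrow> (nat, nat) pa" where
  "pa_of D =
     \<lparr> dimension = desc_dimension D,
       states = set (desc_states D),
       alphabet = set (desc_alphabet D),
       initial = desc_initial D,
       transitions = set (desc_transitions D),
       accepting = set (desc_accepting D),
       target = (\<Union>(b, ps)\<in>set (desc_target D). linear_set (desc_dimension D) b (set ps)) \<rparr>"

definition valid_desc :: "pa_desc \<Rightarrow> bool" where
  "valid_desc D \<longleftrightarrow>
     parikh_automaton (pa_of D) \<and>
     (\<forall>(b, ps)\<in>set (desc_target D).
        b \<in> vectors (desc_dimension D) \<and> set ps \<subseteq> vectors (desc_dimension D))"

fun encode_transition :: "(nat, nat) transition \<Rightarrow> nat" where
  "encode_transition (p, a, v, q) = list_encode [p, a, list_encode v, q]"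

fun encode_linear :: "nat list \<times> nat list list \<Rightarrow> nat" where
  "encode_linear (b, ps) = prod_encode (list_encode b, list_encode (map list_encode ps))"

definition encode_pa :: "pa_desc \<Rightarrow> nat" where
  "encode_pa D = list_encode
     [desc_dimension D,
      list_encode (desc_states D),
      list_encode (desc_alphabet D),
      desc_initial D,
      list_encode (map encode_transition (desc_transitions D)),
      list_encode (desc_accepting D),
      list_encode (map encode_linear (desc_target D))]"

fun encode_pair :: "pa_desc \<times> pa_desc \<Rightarrow> nat" where
  "encode_pair (D1, D2) = prod_encode (encode_pa D1, encode_pa D2)"

lemma inj_encode_transition: "inj encode_transition"
  by (auto simp: inj_def list_encode_eq)

lemma inj_encode_linear: "inj encode_linear"
  by (auto simp: inj_def list_encode_eq inj_map_eq_map[OF inj_list_encode])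

lemma inj_encode_pa: "inj encode_pa"
  by (auto simp: inj_def encode_pa_def list_encode_eq
      inj_map_eq_map[OF inj_encode_transition] inj_map_eq_map[OF inj_encode_linear])

lemma inj_encode_pair: "inj encode_pair"
  using inj_encode_pa by (auto simp: inj_def)


section \<open>Partial recursive functions and decidability\<close>

text \<open>Kleene's partial recursive functions, given by programs with a relational semantics:
  \<open>computes f xs y\<close> means that \<open>f\<close> is defined on the arguments \<open>xs\<close> with value \<open>y\<close>. The variable
  of recursion or minimization is the first argument.\<close>

datatype recf =
    Zero
  | Succ
  | Proj nat
  | Comp recf "recf list"
  | PrimRec recf recf
  | Minimize recf

inductive computes :: "recf \<Rightarrow> nat list \<Rightarrow> nat \<Rightarrow> bool" where
  zero: "computes Zero xs 0"
| succ: "computes Succ [x] (Suc x)"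
| proj: "i < length xs \<Longrightarrow> computes (Proj i) xs (xs ! i)"
| comp: "length ys = length gs \<Longrightarrow> \<forall>i<length gs. computes (gs ! i) xs (ys ! i) \<Longrightarrow>
    computes f ys y \<Longrightarrow> computes (Comp f gs) xs y"
| prim_0: "computes f xs y \<Longrightarrow> computes (PrimRec f g) (0 # xs) y"
| prim_Suc: "computes (PrimRec f g) (n # xs) u \<Longrightarrow> computes g (n # u # xs) y \<Longrightarrow>
    computes (PrimRec f g) (Suc n # xs) y"
| minimize: "computes f (n # xs) 0 \<Longrightarrow> \<forall>m<n. \<exists>u. computes f (m # xs) (Suc u) \<Longrightarrow>
    computes (Minimize f) xs n"

lemma computes_deterministic: "computes f xs y \<Longrightarrow> computes f xs y' \<Longrightarrow> y = y'"
proof (induction arbitrary: y' rule: computes.induct)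
  case (comp ys gs xs f y)
  from comp.prems obtain ys' where ys': "length ys' = length gs"
    "\<forall>i<length gs. computes (gs ! i) xs (ys' ! i)" "computes f ys' y'"
    by cases auto
  have "ys = ys'"
    using comp.hyps comp.IH ys' by (intro nth_equalityI) auto
  then show ?case using comp.IH ys' by auto
next
  case (minimize f n xs)
  from minimize.prems have *: "computes f (y' # xs) 0"
    "\<forall>m<y'. \<exists>u. computes f (m # xs) (Suc u)" by (cases; auto)+
  show ?case
  proof (rule linorder_cases[of n y'])
    assume "n < y'"
    then show ?thesis using * minimize.IH by fastforce
  next
    assume "y' < n"
    then show ?thesis using * minimize.IH by fastforce
  qed
next
  case (prim_0 f xs y g)
  from prim_0.prems show ?case by cases (auto dest: prim_0.IH)
next
  case (prim_Suc f g n xs u y)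
  from prim_Suc.prems show ?case by cases (auto dest: prim_Suc.IH)
next
  case (zero xs)
  from zero.prems show ?case by cases auto
next
  case (succ x)
  from succ.prems show ?case by cases auto
next
  case (proj i xs)
  from proj.prems show ?case by cases auto
qed

text \<open>A decision problem is given by a set \<open>I\<close> of instances, an encoding of instances by naturals,
  and the property to be decided. The decision procedure must terminate with the right answer on
  every (code of an) instance; its behaviour on other inputs is unconstrained.\<close>

definition decidable_problem :: "('i \<Rightarrow> nat) \<Rightarrow> 'i set \<Rightarrow> ('i \<Rightarrow> bool) \<Rightarrow> bool" where
  "decidable_problem enc I P \<longleftrightarrow>
     (\<exists>f. \<forall>x\<in>I. computes f [enc x] (if P x then 1 else 0))"

definition det_pa_pairs :: "(pa_desc \<times> pa_desc) set" where
  "det_pa_pairs =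
     {(D1, D2). valid_desc D1 \<and> deterministic (pa_of D1) \<and>
                valid_desc D2 \<and> deterministic (pa_of D2) \<and>
                alphabet (pa_of D1) = alphabet (pa_of D2)}"

end

theory Submission
  imports Defs
begin

text \<open>Two deterministic readers that reset at alternate separators of a word
  $u_0 \# u_1 \# u_2 \# \cdots$ compare the Parikh vectors of consecutive blocks: one checks
  $(u_0, u_1), (u_2, u_3), \ldots$ and the other $(0, u_0), (u_1, u_2), \ldots$. Hence some word is
  accepted by both iff a given semi-linear relation admits an infinite chain starting from the zero
  vector. The steps of a counter machine form such a relation. Adding a counter that decreases
  until the machine halts makes infinite chains correspond to halting computations.

  Every partial recursive function is computed by a (nondeterministic) counter machine. From a
  decision procedure one builds a partial recursive function that halts iff the
  procedure answers ``empty'' on the instance obtained from a machine and its own description.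
  The machine for this function gives a contradiction.\<close>

section \<open>Partial recursive functions as regular relations on stores\<close>

text \<open>A reader forgets everything at a reset and its segments are disjoint, so a single reader
  cannot count a block both as successor of the block before it and as predecessor of the block
  after it; the shifted second reader supplies exactly the missing pairs. Only the letter counts of
  a block enter the target set, so a block is a vector in unary. Determinism of the readers is no
  restriction on the machine: every guess sits in the word and in the choice among the linear sets
  of the target.

  A linear set can fix a coordinate to a constant or tie two coordinates together, so zero tests and
  equality tests cost nothing. The graph of a partial recursive function is not semi-linear in
  general; it is therefore split into affine steps joined by composition and iteration, with the
  control state as one more coordinate.

  For the self-application the instance must be computable from the input. The machine is summarized
  by six numbers from which, together with the input, the code of the instance arises by successor
  and pairing alone; hence six is also the number of inputs of the diagonal program.\<close>

text \<open>A pair \<open>(Some k, c)\<close> stands for the affine term $z_k + c$, and \<open>(None, c)\<close> for the constant $c$.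
  An action relates two stores whose entries are affine terms in common parameters $z$; this is
  the shape in which a step becomes a single linear set.\<close>

definition val :: "(nat \<Rightarrow> nat) \<Rightarrow> nat option \<times> nat \<Rightarrow> nat" where
  "val z t = (case fst t of None \<Rightarrow> 0 | Some k \<Rightarrow> z k) + snd t"

type_synonym store = "nat \<Rightarrow> nat"
type_synonym action = "(nat \<Rightarrow> nat option \<times> nat) \<times> (nat \<Rightarrow> nat option \<times> nat)"

definition act_rel :: "action \<Rightarrow> store rel" where
  "act_rel a = {(\<sigma>, \<tau>). \<exists>z. \<sigma> = (\<lambda>i. val z (fst a i)) \<and> \<tau> = (\<lambda>i. val z (snd a i))}"

definition keep :: "nat \<Rightarrow> nat option \<times> nat" where
  "keep i = (Some i, 0)"

lemma val_simps [simp]: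
  "val z (keep i) = z i" "val z (None, c) = c" "val z (Some k, c) = z k + c"
  by (simp_all add: val_def keep_def)

text \<open>The first \<open>N\<close> registers are described by the first \<open>N\<close>
  parameters alone and all others are copied. This allows an action on infinite stores to be cut
  down to vectors of finite length.\<close>

definition act_bound :: "nat \<Rightarrow> action \<Rightarrow> bool" where
  "act_bound N a \<longleftrightarrow>
     (\<forall>i<N. \<forall>k. fst (fst a i) = Some k \<or> fst (snd a i) = Some k \<longrightarrow> k < N) \<and>
     (\<forall>i\<ge>N. fst a i = keep i \<and> snd a i = keep i)"

lemma act_bound_mono:
  assumes "act_bound M a" "M \<le> N"
  shows "act_bound N a"
  unfolding act_bound_def
proof (intro conjI allI impI)
  fix i
  show "fst a i = keep i" "snd a i = keep i" if "N \<le> i"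
    using assms le_trans[OF assms(2) that] unfolding act_bound_def by blast+
  show "k < N" if "i < N" "fst (fst a i) = Some k \<or> fst (snd a i) = Some k" for k
  proof (cases "i < M")
    case True
    then have "k < M" using assms(1) that(2) unfolding act_bound_def by blast
    then show ?thesis using assms(2) by simp
  next
    case False
    then have "M \<le> i" by simp
    then have "fst a i = keep i" "snd a i = keep i" using assms(1) unfolding act_bound_def by blast+
    then show ?thesis using that by (simp add: keep_def)
  qed
qed

text \<open>In the programs below the only choice is the number of iterations of a star; tests
  discard the wrong guesses.\<close>

inductive regular :: "store rel \<Rightarrow> bool" where
  act: "act_bound N a \<Longrightarrow> regular (act_rel a)"
| comp: "regular R \<Longrightarrow> regular S \<Longrightarrow> regular (R O S)"
| star: "regular R \<Longrightarrow> regular (R\<^sup>*)"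

section \<open>Elementary actions: assignments and tests\<close>

lemma regular_actI: "act_bound N a \<Longrightarrow> act_rel a = R \<Longrightarrow> regular R"
  using regular.act by blast

lemma act_rel_skip: "act_rel (keep, keep) = Id"
  by (auto simp: act_rel_def)

lemma act_bound_skip: "act_bound N (keep, keep)"
  by (auto simp: act_bound_def keep_def)

lemma regular_Id: "regular Id"
  by (rule regular_actI[OF act_bound_skip act_rel_skip])

lemma regular_zero: "regular {(\<sigma>, \<tau>). \<tau> = \<sigma>(x := 0)}"
  by (rule regular_actI[of "Suc x" "(keep, keep(x := (None, 0)))"])
     (auto simp: act_bound_def act_rel_def keep_def fun_eq_iff)

lemma regular_copy: "regular {(\<sigma>, \<tau>). \<tau> = \<sigma>(x := \<sigma> y)}"
  by (rule regular_actI[of "Suc (max x y)" "(keep, keep(x := keep y))"])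
     (auto simp: act_bound_def act_rel_def keep_def fun_eq_iff)

lemma regular_inc: "regular {(\<sigma>, \<tau>). \<tau> = \<sigma>(x := Suc (\<sigma> x))}"
  by (rule regular_actI[of "Suc x" "(keep, keep(x := (Some x, 1)))"])
     (auto simp: act_bound_def act_rel_def keep_def fun_eq_iff)

text \<open>A test is a partial identity: both sides carry the same pattern, which only the stores
  passing the test can match. The pattern is the constant 0 here, $z_x + 1$ for positivity, and a
  shared parameter for equality.\<close>

lemma regular_is_zero: "regular {(\<sigma>, \<tau>). \<tau> = \<sigma> \<and> \<sigma> x = 0}"
proof (rule regular_actI[of "Suc x" "(keep(x := (None, 0)), keep(x := (None, 0)))"])
  show "act_rel (keep(x := (None, 0)), keep(x := (None, 0))) = {(\<sigma>, \<tau>). \<tau> = \<sigma> \<and> \<sigma> x = 0}"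
  proof (intro set_eqI iffI; clarify)
    fix \<tau> :: store assume "\<tau> x = 0"
    then show "(\<tau>, \<tau>) \<in> act_rel (keep(x := (None, 0)), keep(x := (None, 0)))"
      unfolding act_rel_def by (auto simp: fun_eq_iff intro!: exI[of _ \<tau>])
  qed (auto simp: act_rel_def fun_eq_iff)
qed (auto simp: act_bound_def keep_def)

lemma regular_pos: "regular {(\<sigma>, \<tau>). \<tau> = \<sigma> \<and> 0 < \<sigma> x}"
proof (rule regular_actI[of "Suc x" "(keep(x := (Some x, 1)), keep(x := (Some x, 1)))"])
  show "act_rel (keep(x := (Some x, 1)), keep(x := (Some x, 1))) = {(\<sigma>, \<tau>). \<tau> = \<sigma> \<and> 0 < \<sigma> x}"
  proof (intro set_eqI iffI; clarify)
    fix \<tau> :: store assume "0 < \<tau> x"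
    then show "(\<tau>, \<tau>) \<in> act_rel (keep(x := (Some x, 1)), keep(x := (Some x, 1)))"
      unfolding act_rel_def by (auto simp: fun_eq_iff intro!: exI[of _ "\<tau>(x := \<tau> x - 1)"])
  qed (auto simp: act_rel_def fun_eq_iff)
qed (auto simp: act_bound_def keep_def)

lemma regular_eq: "regular {(\<sigma>, \<tau>). \<tau> = \<sigma> \<and> \<sigma> x = \<sigma> y}"
proof (rule regular_actI[of "Suc (max x y)" "(keep(x := keep y), keep(x := keep y))"])
  show "act_rel (keep(x := keep y), keep(x := keep y)) = {(\<sigma>, \<tau>). \<tau> = \<sigma> \<and> \<sigma> x = \<sigma> y}"
  proof (intro set_eqI iffI; clarify)
    fix \<tau> :: store assume "\<tau> x = \<tau> y"
    then show "(\<tau>, \<tau>) \<in> act_rel (keep(x := keep y), keep(x := keep y))"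
      unfolding act_rel_def by (auto simp: fun_eq_iff intro!: exI[of _ \<tau>])
  qed (auto simp: act_rel_def fun_eq_iff)
qed (auto simp: act_bound_def keep_def)

text \<open>Implements a program on argument lists whose length makes it undefined.\<close>

lemma regular_empty: "regular {}"
proof -
  have "{(\<sigma>, \<tau>). \<tau> = \<sigma>(0 := 0)} O {(\<sigma>, \<tau>). \<tau> = \<sigma> \<and> 0 < \<sigma> 0} = ({} :: store rel)"
    by auto
  then show ?thesis
    using regular.comp[OF regular_zero[of 0] regular_pos[of 0]] by simp
qed

section \<open>Partial recursive programs compiled to regular relations\<close>

inductive_cases computes_ZeroE: "computes Zero xs y"
inductive_cases computes_SuccE: "computes Succ xs y"
inductive_cases computes_ProjE: "computes (Proj i) xs y"
inductive_cases computes_CompE: "computes (Comp f gs) xs y"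
inductive_cases computes_PrimRecE: "computes (PrimRec f g) xs y"
inductive_cases computes_PrimRec_0E: "computes (PrimRec f g) (0 # xs) y"
inductive_cases computes_PrimRec_SucE: "computes (PrimRec f g) (Suc n # xs) y"
inductive_cases computes_MinimizeE: "computes (Minimize f) xs y"

text \<open>Registers from \<open>fresh\<close> on are scratch space. Partial correctness in both directions is enough,
  since the relations may be nondeterministic: guesses that do not work out have no successor.\<close>

definition implements :: "store rel \<Rightarrow> recf \<Rightarrow> nat list \<Rightarrow> nat \<Rightarrow> nat \<Rightarrow> bool" where
  "implements R g ins out fresh \<longleftrightarrow>
     (\<forall>\<sigma> \<tau>. (\<sigma>, \<tau>) \<in> R \<longrightarrow>
        computes g (map \<sigma> ins) (\<tau> out) \<and> (\<forall>r<fresh. r \<noteq> out \<longrightarrow> \<tau> r = \<sigma> r)) \<and>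
     (\<forall>\<sigma> y. computes g (map \<sigma> ins) y \<longrightarrow> (\<exists>\<tau>. (\<sigma>, \<tau>) \<in> R))"

lemma implementsD:
  assumes "implements R g ins out fresh"
  shows "(\<sigma>, \<tau>) \<in> R \<Longrightarrow> computes g (map \<sigma> ins) (\<tau> out)"
    and "(\<sigma>, \<tau>) \<in> R \<Longrightarrow> r < fresh \<Longrightarrow> r \<noteq> out \<Longrightarrow> \<tau> r = \<sigma> r"
    and "computes g (map \<sigma> ins) y \<Longrightarrow> \<exists>\<tau>. (\<sigma>, \<tau>) \<in> R"
  using assms by (auto simp: implements_def)

lemma implementsI:
  assumes "\<And>\<sigma> \<tau>. (\<sigma>, \<tau>) \<in> R \<Longrightarrow> computes g (map \<sigma> ins) (\<tau> out)"
    and "\<And>\<sigma> \<tau> r. (\<sigma>, \<tau>) \<in> R \<Longrightarrow> r < fresh \<Longrightarrow> r \<noteq> out \<Longrightarrow> \<tau> r = \<sigma> r"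
    and "\<And>\<sigma> y. computes g (map \<sigma> ins) y \<Longrightarrow> \<exists>\<tau>. (\<sigma>, \<tau>) \<in> R"
  shows "implements R g ins out fresh"
  unfolding implements_def by (intro conjI allI impI; rule assms; assumption)

text \<open>Quantifying over all register layouts lets the induction place the scratch space of a
  sub-program above the registers of its caller.\<close>

abbreviation implementable :: "recf \<Rightarrow> bool" where
  "implementable g \<equiv> \<forall>ins out fresh. set ins \<subseteq> {..<fresh} \<longrightarrow>
     (\<exists>R. regular R \<and> implements R g ins out fresh)"

lemma implementable_Zero: "implementable Zero"
proof (intro allI impI exI conjI)
  fix ins out fresh
  show "regular {(\<sigma>, \<tau>). \<tau> = \<sigma>(out := 0)}" by (rule regular_zero)
  show "implements {(\<sigma>, \<tau>). \<tau> = \<sigma>(out := 0)} Zero ins out fresh"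
    by (rule implementsI) (auto intro: computes.intros)
qed

lemma implementable_Succ: "implementable Succ"
proof (intro allI impI)
  fix ins :: "nat list" and out fresh :: nat
  show "\<exists>R. regular R \<and> implements R Succ ins out fresh"
  proof (cases "\<exists>x. ins = [x]")
    case True
    then obtain x where "ins = [x]" by blast
    then have "implements ({(\<sigma>, \<tau>). \<tau> = \<sigma>(out := \<sigma> x)} O {(\<sigma>, \<tau>). \<tau> = \<sigma>(out := Suc (\<sigma> out))})
        Succ ins out fresh"
      by (intro implementsI) (auto intro: computes.intros)
    then show ?thesis using regular.comp[OF regular_copy regular_inc] by blast
  next
    case False
    then have "implements {} Succ ins out fresh"
      by (intro implementsI) (auto elim!: computes_SuccE)
    then show ?thesis using regular_empty by blast
  qed
qed

lemma implementable_Proj: "implementable (Proj i)"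
proof (intro allI impI)
  fix ins :: "nat list" and out fresh :: nat
  show "\<exists>R. regular R \<and> implements R (Proj i) ins out fresh"
  proof (cases "i < length ins")
    case True
    then have "computes (Proj i) (map \<sigma> ins) (\<sigma> (ins ! i))" for \<sigma>
      using computes.proj[of i "map \<sigma> ins"] by simp
    then have "implements {(\<sigma>, \<tau>). \<tau> = \<sigma>(out := \<sigma> (ins ! i))} (Proj i) ins out fresh"
      by (intro implementsI) auto
    then show ?thesis using regular_copy by blast
  next
    case False
    then have "implements {} (Proj i) ins out fresh"
      by (intro implementsI) (auto elim!: computes_ProjE)
    then show ?thesis using regular_empty by blast
  qed
qed

text \<open>Results are stored in the registers from \<open>fresh\<close> on. Each call gets scratch
  space above the results already stored, and the inputs lie below \<open>fresh\<close>, so neither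
  is overwritten.\<close>

lemma implementable_args:
  assumes "\<And>j. j < m \<Longrightarrow> implementable (gs ! j)" and ins: "set ins \<subseteq> {..<fresh}"
  shows "\<exists>R. regular R \<and>
    (\<forall>\<sigma> \<tau>. (\<sigma>, \<tau>) \<in> R \<longrightarrow>
       (\<forall>j<m. computes (gs ! j) (map \<sigma> ins) (\<tau> (fresh + j))) \<and> (\<forall>r<fresh. \<tau> r = \<sigma> r)) \<and>
    (\<forall>\<sigma>. (\<forall>j<m. \<exists>y. computes (gs ! j) (map \<sigma> ins) y) \<longrightarrow> (\<exists>\<tau>. (\<sigma>, \<tau>) \<in> R))"
  using assms(1)
proof (induction m)
  case 0
  show ?case using regular_Id by (intro exI[of _ Id]) auto
next
  case (Suc m)
  obtain R where R: "regular R"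
    "\<And>\<sigma> \<tau> j. (\<sigma>, \<tau>) \<in> R \<Longrightarrow> j < m \<Longrightarrow> computes (gs ! j) (map \<sigma> ins) (\<tau> (fresh + j))"
    "\<And>\<sigma> \<tau> r. (\<sigma>, \<tau>) \<in> R \<Longrightarrow> r < fresh \<Longrightarrow> \<tau> r = \<sigma> r"
    "\<And>\<sigma>. \<forall>j<m. \<exists>y. computes (gs ! j) (map \<sigma> ins) y \<Longrightarrow> \<exists>\<tau>. (\<sigma>, \<tau>) \<in> R"
    using Suc.IH[OF Suc.prems[OF less_SucI]] by blast
  have "set ins \<subseteq> {..<fresh + Suc m}" using ins by auto
  then obtain S where S: "regular S" "implements S (gs ! m) ins (fresh + m) (fresh + Suc m)"
    using Suc.prems[of m] by blast
  note S' = implementsD[OF S(2)]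
  have same: "map \<mu> ins = map \<sigma> ins" if "(\<sigma>, \<mu>) \<in> R" for \<sigma> \<mu>
    using R(3)[OF that] ins by auto
  show ?case
  proof (intro exI[of _ "R O S"] conjI allI impI)
    show "regular (R O S)" using R(1) S(1) by (rule regular.comp)
    fix \<sigma>
    show "computes (gs ! j) (map \<sigma> ins) (\<tau> (fresh + j))" if st: "(\<sigma>, \<tau>) \<in> R O S" and "j < Suc m" for \<tau> j
    proof -
      obtain \<mu> where \<mu>: "(\<sigma>, \<mu>) \<in> R" "(\<mu>, \<tau>) \<in> S" using st by blast
      show ?thesis
      proof (cases "j = m")
        case True
        then show ?thesis using S'(1)[OF \<mu>(2)] same[OF \<mu>(1)] by simp
      next
        case False
        then show ?thesis using R(2)[OF \<mu>(1), of j] S'(2)[OF \<mu>(2), of "fresh + j"] \<open>j < Suc m\<close> by simp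
      qed
    qed
    show "\<tau> r = \<sigma> r" if st: "(\<sigma>, \<tau>) \<in> R O S" and "r < fresh" for \<tau> r
    proof -
      obtain \<mu> where "(\<sigma>, \<mu>) \<in> R" "(\<mu>, \<tau>) \<in> S" using st by blast
      then show ?thesis using R(3)[of \<sigma> \<mu> r] S'(2)[of \<mu> \<tau> r] \<open>r < fresh\<close> by simp
    qed
    assume ex: "\<forall>j<Suc m. \<exists>y. computes (gs ! j) (map \<sigma> ins) y"
    then obtain \<mu> where \<mu>: "(\<sigma>, \<mu>) \<in> R" using R(4)[of \<sigma>] by auto
    obtain y where "computes (gs ! m) (map \<mu> ins) y" using ex same[OF \<mu>] by auto
    then show "\<exists>\<tau>. (\<sigma>, \<tau>) \<in> R O S" using S'(3) \<mu> by blast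
  qed
qed

lemma implementable_Comp:
  assumes f: "implementable f" and gs: "\<And>g. g \<in> set gs \<Longrightarrow> implementable g"
  shows "implementable (Comp f gs)"
proof (intro allI impI)
  fix ins :: "nat list" and out fresh :: nat
  assume ins: "set ins \<subseteq> {..<fresh}"
  let ?m = "length gs"
  obtain R where R: "regular R"
    "\<And>\<sigma> \<tau> j. (\<sigma>, \<tau>) \<in> R \<Longrightarrow> j < ?m \<Longrightarrow> computes (gs ! j) (map \<sigma> ins) (\<tau> (fresh + j))"
    "\<And>\<sigma> \<tau> r. (\<sigma>, \<tau>) \<in> R \<Longrightarrow> r < fresh \<Longrightarrow> \<tau> r = \<sigma> r"
    "\<And>\<sigma>. \<forall>j<?m. \<exists>y. computes (gs ! j) (map \<sigma> ins) y \<Longrightarrow> \<exists>\<tau>. (\<sigma>, \<tau>) \<in> R"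
    using implementable_args[of ?m gs, OF gs[OF nth_mem] ins] by blast
  have "set [fresh..<fresh + ?m] \<subseteq> {..<fresh + ?m}" by auto
  then obtain S where S: "regular S" "implements S f [fresh..<fresh + ?m] out (fresh + ?m)"
    using f by blast
  note S' = implementsD[OF S(2)]
  have "implements (R O S) (Comp f gs) ins out fresh"
  proof (rule implementsI)
    fix \<sigma> \<tau> assume "(\<sigma>, \<tau>) \<in> R O S"
    then obtain \<mu> where \<mu>: "(\<sigma>, \<mu>) \<in> R" "(\<mu>, \<tau>) \<in> S" by blast
    show "computes (Comp f gs) (map \<sigma> ins) (\<tau> out)"
      by (rule computes.comp[OF _ _ S'(1)[OF \<mu>(2)]]) (use R(2)[OF \<mu>(1)] in auto)
    show "\<tau> r = \<sigma> r" if "r < fresh" "r \<noteq> out" for r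
      using that R(3)[OF \<mu>(1), of r] S'(2)[OF \<mu>(2), of r] by simp
  next
    fix \<sigma> y assume "computes (Comp f gs) (map \<sigma> ins) y"
    then obtain ys where ys: "length ys = ?m" "\<forall>j<?m. computes (gs ! j) (map \<sigma> ins) (ys ! j)"
      "computes f ys y" by (elim computes_CompE) auto
    then obtain \<mu> where \<mu>: "(\<sigma>, \<mu>) \<in> R" using R(4)[of \<sigma>] by blast
    have "map \<mu> [fresh..<fresh + ?m] = ys"
      using ys(1,2) computes_deterministic[OF R(2)[OF \<mu>]] by (intro nth_equalityI) auto
    then show "\<exists>\<tau>. (\<sigma>, \<tau>) \<in> R O S" using S'(3)[of \<mu> y] ys(3) \<mu> by auto
  qed
  then show "\<exists>R. regular R \<and> implements R (Comp f gs) ins out fresh"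
    using regular.comp[OF R(1) S(1)] by blast
qed

text \<open>The loop runs a guessed number of times, \<open>i\<close> counting the rounds and
  \<open>u\<close> holding the value of the recursion at \<open>i\<close>; the test
  \<open>i = n\<close> then rejects every other guess.\<close>

lemma implementable_PrimRec:
  assumes f: "implementable f" and g: "implementable g"
  shows "implementable (PrimRec f g)"
proof (intro allI impI)
  fix ins :: "nat list" and out fresh :: nat
  assume ins: "set ins \<subseteq> {..<fresh}"
  show "\<exists>R. regular R \<and> implements R (PrimRec f g) ins out fresh"
  proof (cases ins)
    case Nil
    then have "implements {} (PrimRec f g) ins out fresh"
      by (intro implementsI) (auto elim: computes_PrimRecE)
    then show ?thesis using regular_empty by blast
  next
    case (Cons n xs)
    define i u w fr where "i = fresh" and "u = fresh + 1" and "w = fresh + 2" and "fr = fresh + 3"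
    note regs = i_def u_def w_def fr_def
    have nx: "n < fresh" "\<And>x. x \<in> set xs \<Longrightarrow> x < fresh" using ins Cons by auto
    have "set xs \<subseteq> {..<fr}" using nx(2) by (fastforce simp: regs)
    then obtain F where F: "regular F" "implements F f xs u fr" using f by blast
    note F' = implementsD[OF F(2)]
    have "set (i # u # xs) \<subseteq> {..<fr}" using nx(2) by (fastforce simp: regs)
    then obtain G where G: "regular G" "implements G g (i # u # xs) w fr" using g by blast
    note G' = implementsD[OF G(2)]
    define B where "B = G O {(\<sigma>, \<tau>). \<tau> = \<sigma>(u := \<sigma> w)} O {(\<sigma>, \<tau>). \<tau> = \<sigma>(i := Suc (\<sigma> i))}"
    define R where "R = F O {(\<sigma>, \<tau>). \<tau> = \<sigma>(i := 0)} O B\<^sup>* O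
      {(\<sigma>, \<tau>). \<tau> = \<sigma> \<and> \<sigma> i = \<sigma> n} O {(\<sigma>, \<tau>). \<tau> = \<sigma>(out := \<sigma> u)}"
    have reg: "regular R"
      unfolding R_def B_def by (intro regular.comp regular.star F(1) G(1)
        regular_zero regular_copy regular_inc regular_eq)
    define I where "I \<sigma> \<mu> \<longleftrightarrow> (\<forall>r<fresh. \<mu> r = \<sigma> r) \<and>
      computes (PrimRec f g) (\<mu> i # map \<sigma> xs) (\<mu> u)" for \<sigma> \<mu> :: store
    have xs_eq: "map \<mu> xs = map \<sigma> xs" if "\<forall>r<fresh. \<mu> r = \<sigma> r" for \<mu> \<sigma> :: store
      using that nx(2) by auto
    have I0: "I \<sigma> (\<mu>(i := 0))" if "(\<sigma>, \<mu>) \<in> F" for \<sigma> \<mu>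
      using F'(1)[OF that] F'(2)[OF that] unfolding I_def by (auto simp: regs intro: computes.prim_0)
    have IS: "I \<sigma> \<nu> \<and> \<nu> i = Suc (\<mu> i)" if B: "(\<mu>, \<nu>) \<in> B" and I: "I \<sigma> \<mu>" for \<sigma> \<mu> \<nu>
    proof -
      obtain \<kappa> where \<kappa>: "(\<mu>, \<kappa>) \<in> G" "\<nu> = \<kappa>(u := \<kappa> w, i := Suc (\<kappa> i))"
        using B by (auto simp: B_def regs)
      have fr: "\<kappa> r = \<mu> r" if "r < fresh + 2" for r
        using G'(2)[OF \<kappa>(1), of r] that by (auto simp: regs)
      have "computes g (\<mu> i # \<mu> u # map \<sigma> xs) (\<kappa> w)"
        using G'(1)[OF \<kappa>(1)] I xs_eq[of \<mu> \<sigma>] unfolding list.map I_def by metis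
      then have "computes (PrimRec f g) (Suc (\<mu> i) # map \<sigma> xs) (\<kappa> w)"
        using I unfolding I_def by (auto intro: computes.prim_Suc)
      then show ?thesis
        using I fr unfolding I_def \<kappa>(2) by (auto simp: regs)
    qed
    have ex: "\<exists>\<kappa> \<mu>. (\<sigma>, \<kappa>) \<in> F \<and> (\<kappa>(i := 0), \<mu>) \<in> B\<^sup>* \<and> I \<sigma> \<mu> \<and> \<mu> i = k"
      if "computes (PrimRec f g) (k # map \<sigma> xs) y" for \<sigma> k y
      using that
    proof (induction k arbitrary: y)
      case 0
      then obtain \<kappa> where \<kappa>: "(\<sigma>, \<kappa>) \<in> F" using F'(3) by (blast elim: computes_PrimRec_0E)
      show ?case
        by (intro exI conjI, rule \<kappa>, rule rtrancl.rtrancl_refl, rule I0[OF \<kappa>], rule fun_upd_same)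
    next
      case (Suc k)
      obtain v where v: "computes (PrimRec f g) (k # map \<sigma> xs) v"
        "computes g (k # v # map \<sigma> xs) y"
        by (rule computes_PrimRec_SucE[OF Suc.prems])
      obtain \<kappa> \<mu> where \<mu>: "(\<sigma>, \<kappa>) \<in> F" "(\<kappa>(i := 0), \<mu>) \<in> B\<^sup>*" "I \<sigma> \<mu>" "\<mu> i = k"
        using Suc.IH[OF v(1)] by blast
      \<comment> \<open>The run given by induction leaves some value of the recursion in
        \<open>u\<close>; determinism of \<open>computes\<close> makes it the value \<open>v\<close>
        that the next round has to consume.\<close>
      have "\<mu> u = v" using \<mu>(3,4) v(1) by (auto simp: I_def dest: computes_deterministic)
      then have eq: "map \<mu> (i # u # xs) = k # v # map \<sigma> xs"
        using \<mu>(3,4) xs_eq[of \<mu> \<sigma>] by (simp add: I_def)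
      obtain \<nu> where \<nu>: "(\<mu>, \<nu>) \<in> G" using G'(3)[of \<mu> y] v(2) unfolding eq by blast
      have B: "(\<mu>, \<nu>(u := \<nu> w, i := Suc ((\<nu>(u := \<nu> w)) i))) \<in> B"
        unfolding B_def by (rule relcompI[OF \<nu>]) (simp add: relcomp_unfold)
      show ?case
        using \<mu>(1) rtrancl.rtrancl_into_rtrancl[OF \<mu>(2) B] IS[OF B \<mu>(3)] \<mu>(4) by blast
    qed
    have "implements R (PrimRec f g) ins out fresh"
    proof (rule implementsI)
      fix \<sigma> \<tau> assume "(\<sigma>, \<tau>) \<in> R"
      then obtain \<mu> \<nu> where \<mu>: "(\<sigma>, \<mu>) \<in> F" "(\<mu>(i := 0), \<nu>) \<in> B\<^sup>*"
        "\<nu> i = \<nu> n" "\<tau> = \<nu>(out := \<nu> u)" by (auto simp: R_def)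
      have I: "I \<sigma> \<nu>"
        using \<mu>(2)
      proof (induction rule: rtrancl_induct)
        case base
        show ?case by (rule I0[OF \<mu>(1)])
      next
        case step
        then show ?case using IS by blast
      qed
      have "\<nu> i = \<sigma> n" using I \<mu>(3) nx(1) by (simp add: I_def)
      then show "computes (PrimRec f g) (map \<sigma> ins) (\<tau> out)"
        using I \<mu>(4) by (simp add: I_def Cons)
      show "\<tau> r = \<sigma> r" if "r < fresh" "r \<noteq> out" for r
        using that I \<mu>(4) by (simp add: I_def)
    next
      fix \<sigma> y assume "computes (PrimRec f g) (map \<sigma> ins) y"
      then have "computes (PrimRec f g) (\<sigma> n # map \<sigma> xs) y" by (simp add: Cons)
      then obtain \<kappa> \<mu> where \<mu>: "(\<sigma>, \<kappa>) \<in> F" "(\<kappa>(i := 0), \<mu>) \<in> B\<^sup>*" "I \<sigma> \<mu>" "\<mu> i = \<sigma> n"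
        using ex by blast
      have eq: "\<mu> i = \<mu> n" using \<mu>(3,4) nx(1) by (simp add: I_def)
      have "(\<sigma>, \<mu>(out := \<mu> u)) \<in> R"
        unfolding R_def
        by (rule relcompI[OF \<mu>(1)], rule relcompI[of _ "\<kappa>(i := 0)"], simp,
            rule relcompI[OF \<mu>(2)], simp add: relcomp_unfold eq)
      then show "\<exists>\<tau>. (\<sigma>, \<tau>) \<in> R" by blast
    qed
    then show ?thesis using reg by blast
  qed
qed

text \<open>The test in the loop body certifies that every value passed over was positive, and the
  test after one further call of \<open>F\<close> certifies the zero at the guessed
  argument.\<close>

lemma implementable_Minimize:
  assumes f: "implementable f"
  shows "implementable (Minimize f)"
proof (intro allI impI)
  fix ins :: "nat list" and out fresh :: nat
  assume ins: "set ins \<subseteq> {..<fresh}"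
  define i u fr where "i = fresh" and "u = fresh + 1" and "fr = fresh + 2"
  note regs = i_def u_def fr_def
  have "set (i # ins) \<subseteq> {..<fr}" using ins by (fastforce simp: regs)
  then obtain F where F: "regular F" "implements F f (i # ins) u fr" using f by blast
  note F' = implementsD[OF F(2)]
  define B where "B = F O {(\<sigma>, \<tau>). \<tau> = \<sigma> \<and> 0 < \<sigma> u} O {(\<sigma>, \<tau>). \<tau> = \<sigma>(i := Suc (\<sigma> i))}"
  define R where "R = {(\<sigma>, \<tau>). \<tau> = \<sigma>(i := 0)} O B\<^sup>* O F O
    {(\<sigma>, \<tau>). \<tau> = \<sigma> \<and> \<sigma> u = 0} O {(\<sigma>, \<tau>). \<tau> = \<sigma>(out := \<sigma> i)}"
  have reg: "regular R"
    unfolding R_def B_def by (intro regular.comp regular.star F(1)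
      regular_zero regular_copy regular_inc regular_pos regular_is_zero)
  define I where "I \<sigma> \<mu> \<longleftrightarrow> (\<forall>r<fresh. \<mu> r = \<sigma> r) \<and>
    (\<forall>m<\<mu> i. \<exists>v. computes f (m # map \<sigma> ins) (Suc v))" for \<sigma> \<mu> :: store
  have ins_eq: "map \<mu> ins = map \<sigma> ins" if "\<forall>r<fresh. \<mu> r = \<sigma> r" for \<mu> \<sigma> :: store
    using that ins by auto
  have FI: "computes f (\<mu> i # map \<sigma> ins) (\<kappa> u)" "\<kappa> i = \<mu> i" "\<forall>r<fresh. \<kappa> r = \<sigma> r"
    if "(\<mu>, \<kappa>) \<in> F" "I \<sigma> \<mu>" for \<sigma> \<mu> \<kappa>
  proof -
    have same: "\<forall>r<fresh. \<mu> r = \<sigma> r" using that(2) by (simp add: I_def)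
    show "computes f (\<mu> i # map \<sigma> ins) (\<kappa> u)"
      using F'(1)[OF that(1)] unfolding list.map ins_eq[OF same] .
    show "\<kappa> i = \<mu> i" "\<forall>r<fresh. \<kappa> r = \<sigma> r"
      using F'(2)[OF that(1)] same by (simp_all add: regs)
  qed
  have I0: "I \<sigma> (\<sigma>(i := 0))" for \<sigma> by (simp add: I_def regs)
  have IS: "I \<sigma> \<nu> \<and> \<nu> i = Suc (\<mu> i)" if B: "(\<mu>, \<nu>) \<in> B" and I: "I \<sigma> \<mu>" for \<sigma> \<mu> \<nu>
  proof -
    obtain \<kappa> where \<kappa>: "(\<mu>, \<kappa>) \<in> F" "0 < \<kappa> u" "\<nu> = \<kappa>(i := Suc (\<kappa> i))"
      using B by (auto simp: B_def)
    obtain v where "\<kappa> u = Suc v" using \<kappa>(2) gr0_implies_Suc by blast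
    then show ?thesis
      using FI[OF \<kappa>(1) I] I unfolding I_def \<kappa>(3) by (auto simp: less_Suc_eq i_def)
  qed
  have ex: "\<exists>\<mu>. (\<sigma>(i := 0), \<mu>) \<in> B\<^sup>* \<and> I \<sigma> \<mu> \<and> \<mu> i = k"
    if "\<forall>m<k. \<exists>v. computes f (m # map \<sigma> ins) (Suc v)" for \<sigma> k
    using that
  proof (induction k)
    case 0
    from I0[of \<sigma>] show ?case 
      by (intro exI[of _ "\<sigma>(i := 0)"] conjI fun_upd_same rtrancl.rtrancl_refl)
  next
    case (Suc k)
    then obtain \<mu> where \<mu>: "(\<sigma>(i := 0), \<mu>) \<in> B\<^sup>*" "I \<sigma> \<mu>" "\<mu> i = k"
      using less_SucI by blast
    obtain v where v: "computes f (k # map \<sigma> ins) (Suc v)" using Suc.prems by blast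
    have eq: "map \<mu> (i # ins) = k # map \<sigma> ins"
      using \<mu>(2,3) ins_eq[of \<mu> \<sigma>] by (simp add: I_def)
    obtain \<kappa> where \<kappa>: "(\<mu>, \<kappa>) \<in> F" using F'(3)[of \<mu> "Suc v"] v unfolding eq by blast
    have "\<kappa> u = Suc v"
      using FI(1)[OF \<kappa> \<mu>(2)] v \<mu>(3) by (auto dest: computes_deterministic)
    then have B: "(\<mu>, \<kappa>(i := Suc (\<kappa> i))) \<in> B"
      unfolding B_def by (intro relcompI[OF \<kappa>]) (simp add: relcomp_unfold)
    show ?case
      using rtrancl.rtrancl_into_rtrancl[OF \<mu>(1) B] IS[OF B \<mu>(2)] \<mu>(3) by blast
  qed
  have "implements R (Minimize f) ins out fresh"
  proof (rule implementsI)
    fix \<sigma> \<tau> assume "(\<sigma>, \<tau>) \<in> R"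
    then obtain \<mu> \<nu> where \<mu>: "(\<sigma>(i := 0), \<mu>) \<in> B\<^sup>*" "(\<mu>, \<nu>) \<in> F"
      "\<nu> u = 0" "\<tau> = \<nu>(out := \<nu> i)" by (auto simp: R_def)
    have I: "I \<sigma> \<mu>"
      using \<mu>(1)
    proof (induction rule: rtrancl_induct)
      case base
      show ?case by (rule I0)
    next
      case step
      then show ?case using IS by blast
    qed
    show "computes (Minimize f) (map \<sigma> ins) (\<tau> out)"
      using FI[OF \<mu>(2) I] I \<mu>(3,4) by (auto simp: I_def intro!: computes.minimize)
    show "\<tau> r = \<sigma> r" if "r < fresh" "r \<noteq> out" for r
      using that FI(3)[OF \<mu>(2) I] \<mu>(4) by simp
  next
    fix \<sigma> y assume "computes (Minimize f) (map \<sigma> ins) y"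
    then have y: "computes f (y # map \<sigma> ins) 0"
      "\<forall>m<y. \<exists>v. computes f (m # map \<sigma> ins) (Suc v)"
      by (auto elim: computes_MinimizeE)
    then obtain \<mu> where \<mu>: "(\<sigma>(i := 0), \<mu>) \<in> B\<^sup>*" "I \<sigma> \<mu>" "\<mu> i = y"
      using ex by blast
    have eq: "map \<mu> (i # ins) = y # map \<sigma> ins"
      using \<mu>(2,3) ins_eq[of \<mu> \<sigma>] by (simp add: I_def)
    obtain \<nu> where \<nu>: "(\<mu>, \<nu>) \<in> F" using F'(3)[of \<mu> 0] y(1) unfolding eq by blast
    have u0: "\<nu> u = 0"
      using FI(1)[OF \<nu> \<mu>(2)] y(1) \<mu>(3) by (auto dest: computes_deterministic)
    have "(\<sigma>, \<nu>(out := \<nu> i)) \<in> R"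
      unfolding R_def
      by (rule relcompI[of _ "\<sigma>(i := 0)"], simp, rule relcompI[OF \<mu>(1)],
          rule relcompI[OF \<nu>], simp add: relcomp_unfold u0)
    then show "\<exists>\<tau>. (\<sigma>, \<tau>) \<in> R" by blast
  qed
  then show "\<exists>R. regular R \<and> implements R (Minimize f) ins out fresh" using reg by blast
qed

lemma recf_implementable: "implementable g"
proof (induction g)
  case Zero show ?case by (rule implementable_Zero)
next
  case Succ show ?case by (rule implementable_Succ)
next
  case (Proj i) show ?case by (rule implementable_Proj)
next
  case (Comp f gs) then show ?case by (intro implementable_Comp) auto
next
  case (PrimRec f g) then show ?case by (rule implementable_PrimRec)
next
  case (Minimize f) then show ?case by (rule implementable_Minimize)
qed

section \<open>Control states\<close>

type_synonym edge = "nat \<times> action \<times> nat"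

definition moves :: "edge set \<Rightarrow> (nat \<times> store) rel" where
  "moves T = {((p, \<sigma>), (q, \<tau>)) | p \<sigma> q \<tau>. \<exists>a. (p, a, q) \<in> T \<and> (\<sigma>, \<tau>) \<in> act_rel a}"

text \<open>No edge leaves the exit \<open>t\<close>, whereas the entry \<open>s\<close> may be
  entered again. Programs on adjacent intervals can thus be glued at their common state.\<close>

definition program :: "edge set \<Rightarrow> nat \<Rightarrow> nat \<Rightarrow> store rel \<Rightarrow> bool" where
  "program T s t R \<longleftrightarrow> finite T \<and> s < t \<and>
     (\<forall>(p, a, q) \<in> T. s \<le> p \<and> p < t \<and> s \<le> q \<and> q \<le> t) \<and>
     (\<exists>N. \<forall>(p, a, q) \<in> T. act_bound N a) \<and>
     (\<forall>\<sigma> \<tau>. ((s, \<sigma>), (t, \<tau>)) \<in> (moves T)\<^sup>* \<longleftrightarrow> (\<sigma>, \<tau>) \<in> R)"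

lemma moves_mono: "S \<subseteq> T \<Longrightarrow> (moves S)\<^sup>* \<subseteq> (moves T)\<^sup>*"
  by (rule rtrancl_mono) (unfold moves_def, blast)

lemma movesI: "(p, a, q) \<in> T \<Longrightarrow> (\<sigma>, \<tau>) \<in> act_rel a \<Longrightarrow> ((p, \<sigma>), (q, \<tau>)) \<in> moves T"
  unfolding moves_def by blast

lemma movesE:
  assumes "((p, \<sigma>), (q, \<tau>)) \<in> moves T"
  obtains a where "(p, a, q) \<in> T" "(\<sigma>, \<tau>) \<in> act_rel a"
  using assms unfolding moves_def by blast

lemma moves_skip: "(p, (keep, keep), q) \<in> T \<Longrightarrow> ((p, \<sigma>), (q, \<sigma>)) \<in> moves T"
  by (rule movesI, assumption) (unfold act_rel_skip, rule IdI)

lemma program_act: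
  assumes "act_bound N a"
  shows "program {(s, a, Suc s)} s (Suc s) (act_rel a)"
proof -
  let ?T = "{(s, a, Suc s)}"
  have "(\<sigma>, \<tau>) \<in> act_rel a" if "((s, \<sigma>), (Suc s, \<tau>)) \<in> (moves ?T)\<^sup>*" for \<sigma> \<tau>
    using that
  proof (cases rule: converse_rtranclE)
    case (step y)
    then obtain \<mu> where y: "y = (Suc s, \<mu>)" "(\<sigma>, \<mu>) \<in> act_rel a" by (auto simp: moves_def)
    from step(2) have "\<mu> = \<tau>"
      by (cases rule: converse_rtranclE) (auto simp: moves_def y)
    then show ?thesis using y by simp
  qed auto
  moreover have "((s, \<sigma>), (Suc s, \<tau>)) \<in> (moves ?T)\<^sup>*" if "(\<sigma>, \<tau>) \<in> act_rel a" for \<sigma> \<tau>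
    using that by (intro r_into_rtrancl) (auto simp: moves_def)
  ultimately show ?thesis using assms by (auto simp: program_def)
qed

lemma program_comp:
  assumes T: "program T s m R" and U: "program U m t S"
  shows "program (T \<union> U) s t (R O S)"
proof -
  have T': "\<And>p a q. (p, a, q) \<in> T \<Longrightarrow> s \<le> p \<and> p < m \<and> s \<le> q \<and> q \<le> m"
    "\<And>\<sigma> \<tau>. ((s, \<sigma>), (m, \<tau>)) \<in> (moves T)\<^sup>* \<longleftrightarrow> (\<sigma>, \<tau>) \<in> R" "s < m"
    using T unfolding program_def by blast+
  have U': "\<And>p a q. (p, a, q) \<in> U \<Longrightarrow> m \<le> p \<and> p < t \<and> m \<le> q \<and> q \<le> t"
    "\<And>\<sigma> \<tau>. ((m, \<sigma>), (t, \<tau>)) \<in> (moves U)\<^sup>* \<longleftrightarrow> (\<sigma>, \<tau>) \<in> S" "m < t"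
    using U unfolding program_def by blast+
  \<comment> \<open>Edges of \<open>T\<close> leave only states below \<open>m\<close> and edges of
    \<open>U\<close> stay at \<open>m\<close> or above, so a path crosses \<open>m\<close> once and
    for all. State \<open>m\<close> itself counts as already crossed.\<close>
  have inv: "if p < m then ((s, \<sigma>), (p, \<rho>)) \<in> (moves T)\<^sup>*
      else \<exists>\<mu>. (\<sigma>, \<mu>) \<in> R \<and> ((m, \<mu>), (p, \<rho>)) \<in> (moves U)\<^sup>*"
    if "((s, \<sigma>), (p, \<rho>)) \<in> (moves (T \<union> U))\<^sup>*" for \<sigma> p \<rho>
    using that
  proof (induction rule: rtrancl_induct2)
    case refl
    then show ?case using T'(3) by simp
  next
    case (step p \<rho> q \<kappa>)
    from step.hyps(2) obtain a where a: "(p, a, q) \<in> T \<union> U" "(\<rho>, \<kappa>) \<in> act_rel a"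
      by (rule movesE)
    show ?case
    proof (cases "(p, a, q) \<in> T")
      case True
      from T'(1)[OF this] have "p < m" "q \<le> m" by auto
      moreover from True a(2) have "((p, \<rho>), (q, \<kappa>)) \<in> moves T" by (rule movesI)
      ultimately have "((s, \<sigma>), (q, \<kappa>)) \<in> (moves T)\<^sup>*" "q \<le> m"
        using step.IH by (auto intro: rtrancl.rtrancl_into_rtrancl)
      then show ?thesis using T'(2) by (cases "q = m") auto
    next
      case False
      then have "(p, a, q) \<in> U" using a(1) by blast
      from U'(1)[OF this] have "\<not> p < m" "\<not> q < m" by auto
      moreover from \<open>(p, a, q) \<in> U\<close> a(2) have "((p, \<rho>), (q, \<kappa>)) \<in> moves U" by (rule movesI)
      ultimately show ?thesis using step.IH by (auto intro: rtrancl.rtrancl_into_rtrancl)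
    qed
  qed
  have "((s, \<sigma>), (t, \<tau>)) \<in> (moves (T \<union> U))\<^sup>* \<longleftrightarrow> (\<sigma>, \<tau>) \<in> R O S" for \<sigma> \<tau>
  proof
    assume "((s, \<sigma>), (t, \<tau>)) \<in> (moves (T \<union> U))\<^sup>*"
    from inv[OF this] show "(\<sigma>, \<tau>) \<in> R O S" using U'(2,3) by auto
  next
    assume "(\<sigma>, \<tau>) \<in> R O S"
    then obtain \<mu> where "(\<sigma>, \<mu>) \<in> R" "(\<mu>, \<tau>) \<in> S" by blast
    then have "((s, \<sigma>), (m, \<mu>)) \<in> (moves (T \<union> U))\<^sup>*" "((m, \<mu>), (t, \<tau>)) \<in> (moves (T \<union> U))\<^sup>*"
      using T'(2) U'(2) moves_mono[of T "T \<union> U"] moves_mono[of U "T \<union> U"] by blast+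
    then show "((s, \<sigma>), (t, \<tau>)) \<in> (moves (T \<union> U))\<^sup>*" by (rule rtrancl_trans)
  qed
  moreover have "\<exists>N. \<forall>(p, a, q) \<in> T \<union> U. act_bound N a"
  proof -
    obtain M N where "\<forall>(p, a, q) \<in> T. act_bound M a" "\<forall>(p, a, q) \<in> U. act_bound N a"
      using T U unfolding program_def by blast
    then show ?thesis
      by (intro exI[of _ "max M N"]) (blast intro: act_bound_mono max.cobounded1 max.cobounded2)
  qed
  moreover have "finite (T \<union> U)" using T U unfolding program_def by blast
  moreover have "\<forall>(p, a, q) \<in> T \<union> U. s \<le> p \<and> p < t \<and> s \<le> q \<and> q \<le> t"
    using T'(3) U'(3) by (auto dest!: T'(1) U'(1))
  ultimately show ?thesis using T'(3) U'(3) unfolding program_def by auto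
qed

text \<open>The hub \<open>s\<close> has to be a new state: the body may return to its own entry in
  the middle of an execution, so closing the loop at \<open>Suc s\<close> could mix complete and
  incomplete rounds.\<close>

lemma program_star:
  assumes T: "program T (Suc s) t R"
  shows "program (T \<union> {(s, (keep, keep), Suc s), (t, (keep, keep), s), (s, (keep, keep), Suc t)})
    s (Suc t) (R\<^sup>*)"
    (is "program ?T _ _ _")
proof -
  have T': "\<And>p a q. (p, a, q) \<in> T \<Longrightarrow> Suc s \<le> p \<and> p < t \<and> Suc s \<le> q \<and> q \<le> t"
    "\<And>\<sigma> \<tau>. ((Suc s, \<sigma>), (t, \<tau>)) \<in> (moves T)\<^sup>* \<longleftrightarrow> (\<sigma>, \<tau>) \<in> R" "Suc s < t"
    using T unfolding program_def by blast+
  have inv: "if p = s \<or> p = Suc t then (\<sigma>, \<rho>) \<in> R\<^sup>*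
      else \<exists>\<mu>. (\<sigma>, \<mu>) \<in> R\<^sup>* \<and> ((Suc s, \<mu>), (p, \<rho>)) \<in> (moves T)\<^sup>*"
    if "((s, \<sigma>), (p, \<rho>)) \<in> (moves ?T)\<^sup>*" for \<sigma> p \<rho>
    using that
  proof (induction rule: rtrancl_induct2)
    case refl
    then show ?case by simp
  next
    case (step p \<rho> q \<kappa>)
    from step.hyps(2) obtain a where a: "(p, a, q) \<in> ?T" "(\<rho>, \<kappa>) \<in> act_rel a"
      by (rule movesE)
    from a(1) consider "(p, a, q) \<in> T" | "p = s" "q = Suc s" "a = (keep, keep)"
      | "p = t" "q = s" "a = (keep, keep)" | "p = s" "q = Suc t" "a = (keep, keep)"
      by blast
    then show ?case
    proof cases
      case 1
      from T'(1)[OF this] have "p \<noteq> s \<and> p \<noteq> Suc t" "q \<noteq> s \<and> q \<noteq> Suc t" by auto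
      moreover from 1 a(2) have "((p, \<rho>), (q, \<kappa>)) \<in> moves T" by (rule movesI)
      ultimately show ?thesis using step.IH by (auto intro: rtrancl.rtrancl_into_rtrancl)
    next
      case 2
      then have "\<kappa> = \<rho>" using a(2) act_rel_skip by simp
      then show ?thesis using step.IH 2 T'(3) by auto
    next
      case 3
      then have "\<kappa> = \<rho>" using a(2) act_rel_skip by simp
      then show ?thesis using step.IH 3 T'(2,3) by (auto intro: rtrancl.rtrancl_into_rtrancl)
    next
      case 4
      then have "\<kappa> = \<rho>" using a(2) act_rel_skip by simp
      then show ?thesis using step.IH 4 by auto
    qed
  qed
  have loop: "((s, \<sigma>), (s, \<tau>)) \<in> (moves ?T)\<^sup>*" if "(\<sigma>, \<tau>) \<in> R\<^sup>*" for \<sigma> \<tau>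
    using that
  proof (induction rule: rtrancl_induct)
    case (step \<mu> \<nu>)
    have "((Suc s, \<mu>), (t, \<nu>)) \<in> (moves ?T)\<^sup>*"
      using step.hyps(2) T'(2) moves_mono[of T ?T] by blast
    moreover have "((s, \<mu>), (Suc s, \<mu>)) \<in> moves ?T" "((t, \<nu>), (s, \<nu>)) \<in> moves ?T"
      by (rule moves_skip, blast)+
    ultimately have "((s, \<mu>), (s, \<nu>)) \<in> (moves ?T)\<^sup>*"
      by (meson converse_rtrancl_into_rtrancl rtrancl.rtrancl_into_rtrancl)
    with step.IH show ?case by (rule rtrancl_trans)
  qed blast
  have "((s, \<sigma>), (Suc t, \<tau>)) \<in> (moves ?T)\<^sup>* \<longleftrightarrow> (\<sigma>, \<tau>) \<in> R\<^sup>*" for \<sigma> \<tau>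
  proof
    assume "((s, \<sigma>), (Suc t, \<tau>)) \<in> (moves ?T)\<^sup>*"
    from inv[OF this] show "(\<sigma>, \<tau>) \<in> R\<^sup>*" by simp
  next
    assume "(\<sigma>, \<tau>) \<in> R\<^sup>*"
    from loop[OF this] moves_skip[of s "Suc t" ?T \<tau>]
    show "((s, \<sigma>), (Suc t, \<tau>)) \<in> (moves ?T)\<^sup>*" by (meson UnCI insertCI rtrancl.rtrancl_into_rtrancl)
  qed
  moreover have "\<exists>N. \<forall>(p, a, q) \<in> ?T. act_bound N a"
    using T act_bound_skip unfolding program_def by blast
  moreover have "finite ?T" using T unfolding program_def by blast
  moreover have "\<forall>(p, a, q) \<in> ?T. s \<le> p \<and> p < Suc t \<and> s \<le> q \<and> q \<le> Suc t"
    using T'(3) by (auto dest!: T'(1))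
  ultimately show ?thesis using T'(3) unfolding program_def by auto
qed

text \<open>The start is arbitrary so that sub-programs can be laid out on consecutive
  intervals.\<close>

lemma regular_program: "regular R \<Longrightarrow> \<exists>T t. program T s t R"
proof (induction arbitrary: s rule: regular.induct)
  case act
  then show ?case using program_act by blast
next
  case comp
  then show ?case using program_comp by meson
next
  case star
  then show ?case using program_star by meson
qed

section \<open>Two automata comparing consecutive blocks\<close>

text \<open>The letter $d$ is the separator. States $0$ and $2$ read an old block, state $1$ reads a new
  block; the first $d$ coordinates count the letters of the new block and the last $d$ those of the
  old one. The two automata only differ in their initial state, $0$ or $1$. Starting in state $1$
  amounts to an empty old block in the first segment.\<close>

definition next_state :: "nat \<Rightarrow> nat \<Rightarrow> nat \<Rightarrow> nat" where
  "next_state d p a = (if a < d then if p = 1 then 1 else 0 else if p = 1 then 2 else 1)"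

definition letter_weight :: "nat \<Rightarrow> nat \<Rightarrow> nat \<Rightarrow> nat list" where
  "letter_weight d p a =
     map (\<lambda>j. of_bool (a < d \<and> j = (if p = 1 then a else d + a))) [0..<2 * d]"

definition reader :: "nat \<Rightarrow> nat \<Rightarrow> (nat list \<times> nat list list) list \<Rightarrow> pa_desc" where
  "reader d s L =
     \<lparr> desc_dimension = 2 * d,
       desc_states = [0, 1, 2],
       desc_alphabet = [0..<Suc d],
       desc_initial = s,
       desc_transitions = map (\<lambda>(p, a). (p, a, letter_weight d p a, next_state d p a))
         (List.product [0, 1, 2] [0..<Suc d]),
       desc_accepting = [2],
       desc_target = L \<rparr>"

lemma reader_valid:
  assumes "d \<ge> 1" "s \<le> 2"
    and L: "\<And>b ps. (b, ps) \<in> set L \<Longrightarrow> b \<in> vectors (2 * d) \<and> set ps \<subseteq> vectors (2 * d)"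
  shows "valid_desc (reader d s L)" "deterministic (pa_of (reader d s L))"
proof -
  have "semilinear (2 * d) (\<Union>(b, ps)\<in>set L. linear_set (2 * d) b (set ps))"
    unfolding semilinear_def
  proof (intro exI conjI)
    show "finite ((\<lambda>(b, ps). (b, set ps)) ` set L)" by simp
    show "\<forall>(b, P)\<in>(\<lambda>(b, ps). (b, set ps)) ` set L.
        b \<in> vectors (2 * d) \<and> finite P \<and> P \<subseteq> vectors (2 * d)"
      using L by auto
    show "(\<Union>(b, ps)\<in>set L. linear_set (2 * d) b (set ps)) =
        (\<Union>(b, P)\<in>(\<lambda>(b, ps). (b, set ps)) ` set L. linear_set (2 * d) b P)"
      by auto
  qed
  then show "valid_desc (reader d s L)"
    using assms unfolding valid_desc_def parikh_automaton_def reader_def pa_of_def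
    by (auto simp: vectors_def letter_weight_def next_state_def)
  show "deterministic (pa_of (reader d s L))"
    by (auto simp: deterministic_def reader_def pa_of_def)
qed

primrec run_state :: "nat \<Rightarrow> nat \<Rightarrow> (nat \<Rightarrow> nat) \<Rightarrow> nat \<Rightarrow> nat" where
  "run_state d s w 0 = s"
| "run_state d s w (Suc n) = next_state d (run_state d s w n) (w n)"

lemma run_state_le: "s \<le> 2 \<Longrightarrow> run_state d s w n \<le> 2"
  by (cases n) (auto simp: next_state_def)

definition reader_run :: "nat \<Rightarrow> nat \<Rightarrow> (nat \<Rightarrow> nat) \<Rightarrow> (nat, nat) transition word" where
  "reader_run d s w n = (run_state d s w n, w n, letter_weight d (run_state d s w n) (w n),
     run_state d s w (Suc n))"

lemma reader_transitions:
  "transitions (pa_of (reader d s L)) =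
     {(p, a, letter_weight d p a, next_state d p a) | p a. p \<le> 2 \<and> a \<le> d}"
  by (auto simp: reader_def pa_of_def image_iff less_Suc_eq_le le_Suc_eq numeral_2_eq_2)

lemma reader_simps:
  "alphabet (pa_of (reader d s L)) = {..d}"
  "dimension (pa_of (reader d s L)) = 2 * d"
  "target (pa_of (reader d s L)) = (\<Union>(b, ps)\<in>set L. linear_set (2 * d) b (set ps))"
  by (auto simp: reader_def pa_of_def)

lemma is_run_reader:
  assumes "s \<le> 2" "\<And>i. w i \<le> d"
  shows "is_run (pa_of (reader d s L)) w r \<longleftrightarrow> r = reader_run d s w"
proof
  assume r: "is_run (pa_of (reader d s L)) w r"
  have shape: "r n = (source (r n), w n, letter_weight d (source (r n)) (w n),
      next_state d (source (r n)) (w n))" for n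
  proof -
    have "r n \<in> transitions (pa_of (reader d s L))" "letter (r n) = w n"
      using r by (auto simp: is_run_def)
    then show ?thesis by (auto simp: reader_transitions)
  qed
  have "source (r n) = run_state d s w n" for n
  proof (induction n)
    case 0
    then show ?case using r by (simp add: is_run_def reader_def pa_of_def)
  next
    case (Suc n)
    have "source (r (Suc n)) = dest (r n)" using r by (simp add: is_run_def)
    also have "\<dots> = next_state d (source (r n)) (w n)" by (subst shape) simp
    finally show ?case using Suc by simp
  qed
  then show "r = reader_run d s w" using shape by (intro ext) (metis reader_run_def run_state.simps(2))
next
  assume "r = reader_run d s w"
  then show "is_run (pa_of (reader d s L)) w r"
    using assms run_state_le[OF assms(1)] unfolding is_run_def reader_transitions
    by (auto simp: reader_run_def) (simp add: reader_def pa_of_def)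
qed

lemma vec_sum_segment:
  "vec_sum D (map f [a..<b]) = map (\<lambda>j. \<Sum>n\<in>{a..<b}. f n ! j) [0..<D]"
  by (simp add: vec_sum_def interv_sum_list_conv_sum_set_nat comp_def)

text \<open>On a word over its alphabet the reader has exactly one run, so the existential over runs
  disappears and acceptance speaks of \<open>run_state\<close> only.\<close>

lemma SR_reader:
  fixes d s :: nat
  assumes "s \<le> 2"
  defines "H \<equiv> \<lambda>w. {k. 1 \<le> k \<and> run_state d s w k = 2}"
  shows "w \<in> SR (pa_of (reader d s L)) \<longleftrightarrow> (\<forall>i. w i \<le> d) \<and> infinite (H w) \<and>
    (\<forall>i\<ge>1. map (\<lambda>j. \<Sum>n\<in>{enumerate (insert 0 (H w)) (i - 1)..<enumerate (insert 0 (H w)) i}.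
        letter_weight d (run_state d s w n) (w n) ! j) [0..<2 * d]
      \<in> target (pa_of (reader d s L)))"
proof (cases "\<forall>i. w i \<le> d")
  case True
  let ?A = "pa_of (reader d s L)"
  have hits: "hits ?A (reader_run d s w) = H w"
  proof -
    have "dest (reader_run d s w (k - 1)) = run_state d s w k" if "1 \<le> k" for k
      using that by (cases k) (simp_all add: reader_run_def)
    then show ?thesis by (auto simp: hits_def H_def reader_def pa_of_def)
  qed
  have weight: "map weight (reader_run d s w [a \<rightarrow> b]) =
      map (\<lambda>n. letter_weight d (run_state d s w n) (w n)) [a..<b]" for a b
    by (simp add: subsequence_def reader_run_def)
  have "w \<in> SR ?A \<longleftrightarrow> strong_reset_accepting ?A (reader_run d s w)"
    using True is_run_reader[OF assms(1), of w d L] by (simp add: SR_def reader_simps)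
  moreover have "dimension ?A = 2 * d" by (rule reader_simps)
  ultimately show ?thesis
    using True by (simp add: strong_reset_accepting_def hits reset_pos_def weight vec_sum_segment)
next
  case False
  then show ?thesis by (auto simp: SR_def reader_simps)
qed

section \<open>Block boundaries and reset positions\<close>

lemma enumerate_range:
  fixes f :: "nat \<Rightarrow> nat"
  assumes "strict_mono f"
  shows "enumerate (range f) = f"
proof
  fix n
  have inf: "infinite (range f)"
    using assms strict_mono_imp_inj_on range_inj_infinite by blast
  show "enumerate (range f) n = f n"
  proof (induction n)
    case 0
    show ?case
      unfolding enumerate_0 using assms by (intro Least_equality) (auto simp: strict_mono_less_eq)
  next
    case (Suc n)
    show ?case
      unfolding enumerate_Suc''[OF inf] Suc using assms
      by (intro Least_equality) (auto simp: strict_mono_less_eq strict_mono_less)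
  qed
qed

text \<open>Block \<open>t\<close> occupies the positions from \<open>E t\<close> up to, but
  excluding, \<open>E (Suc t)\<close>; the last of them holds the separator.\<close>

locale blocks =
  fixes d :: nat and w :: "nat \<Rightarrow> nat" and E :: "nat \<Rightarrow> nat"
  assumes letters: "\<And>n. w n \<le> d"
    and mono: "strict_mono E"
    and range: "range E = insert 0 {Suc n | n. w n = d}"
begin

lemma E_0: "E 0 = 0"
proof -
  have "0 \<in> range E" unfolding range by simp
  then obtain t where "0 = E t" by (rule rangeE)
  moreover have "E 0 \<le> E t" using mono by (simp add: strict_mono_less_eq)
  ultimately show ?thesis by simp
qed

lemma E_less [simp]: "E t < E u \<longleftrightarrow> t < u"
  using mono by (rule strict_mono_less)

lemma E_eq [simp]: "E t = E u \<longleftrightarrow> t = u"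
  using mono by (rule strict_mono_eq)

lemma not_in_range: "E t < k \<Longrightarrow> k < E (Suc t) \<Longrightarrow> k \<notin> range E"
  by auto

lemma inside: "E t \<le> n \<Longrightarrow> Suc n < E (Suc t) \<Longrightarrow> w n < d"
  using not_in_range[of t "Suc n"] range letters[of n] by (metis (mono_tags, lifting) CollectI
      insertCI le_imp_less_Suc le_neq_implies_less)

lemma at_end: "Suc n = E (Suc t) \<Longrightarrow> w n = d"
proof -
  assume "Suc n = E (Suc t)"
  then have "Suc n \<in> insert 0 {Suc n | n. w n = d}" unfolding range[symmetric] by simp
  then show ?thesis by simp
qed

lemma block_ex: "\<exists>t. E t \<le> n \<and> n < E (Suc t)"
proof (induction n)
  case 0
  show ?case using E_0 by (intro exI[of _ 0]) (metis E_less le0 lessI)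
next
  case (Suc n)
  then obtain t where t: "E t \<le> n" "n < E (Suc t)" by blast
  show ?case
  proof (cases "Suc n < E (Suc t)")
    case True
    then show ?thesis using t by (intro exI[of _ t]) simp
  next
    case False
    then have "Suc n = E (Suc t)" using t by simp
    then show ?thesis by (intro exI[of _ "Suc t"]) simp
  qed
qed

text \<open>Parity tells old blocks from new ones. State 2 occurs only at a boundary, since the next
  letter, separator or not, leaves it; at \<open>t = 0\<close> no separator has been read, so the
  state is still \<open>s\<close>.\<close>

lemma run_state_block:
  assumes "s \<le> 1"
  shows "run_state d s w (E t) = (if odd (s + t) then 1 else if t = 0 then 0 else 2)"
    and "E t < n \<Longrightarrow> n < E (Suc t) \<Longrightarrow> run_state d s w n = (if odd (s + t) then 1 else 0)"
proof -
  have inner: "run_state d s w n = (if odd (s + t) then 1 else 0)"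
    if start: "run_state d s w (E t) = (if odd (s + t) then 1 else if t = 0 then 0 else 2)"
      and "E t < n" "n < E (Suc t)" for t n
    using that(2,3)
  proof (induction n)
    case (Suc n)
    then have "w n < d" by (intro inside) auto
    then show ?case using Suc start by (cases "n = E t") (auto simp: next_state_def)
  qed simp
  have start: "run_state d s w (E t) = (if odd (s + t) then 1 else if t = 0 then 0 else 2)" for t
  proof (induction t)
    case 0
    have "s = 0 \<or> s = 1" using assms by auto
    then show ?case using E_0 by auto
  next
    case (Suc t)
    have "E t < E (Suc t)" by simp
    then obtain m where m: "E (Suc t) = Suc m" "E t \<le> m" by (cases "E (Suc t)") auto
    have "run_state d s w m = 1 \<longleftrightarrow> odd (s + t)"
      using Suc inner[OF Suc, of m] m by (cases "m = E t") auto
    then show ?case using at_end[of m t] m(1) by (simp add: next_state_def)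
  qed
  show "run_state d s w (E t) = (if odd (s + t) then 1 else if t = 0 then 0 else 2)" by (rule start)
  show "run_state d s w n = (if odd (s + t) then 1 else 0)" if "E t < n" "n < E (Suc t)"
    using inner[OF start that] .
qed

text \<open>Truncated subtraction makes \<open>i = 0\<close> give position 0 for both values of
  \<open>s\<close>, which is the conventional first reset $k_0 = 0$. For \<open>s = 1\<close> the
  resets are then at \<open>E 0\<close>, \<open>E 1\<close>, \<open>E 3\<close> and so on.\<close>

lemma resets:
  assumes "s \<le> 1"
  shows "insert 0 {k. 1 \<le> k \<and> run_state d s w k = 2} = range (\<lambda>i. E (2 * i - s))"
proof (intro set_eqI iffI)
  fix k assume "k \<in> insert 0 {k. 1 \<le> k \<and> run_state d s w k = 2}"
  then consider "k = 0" | "run_state d s w k = 2" by auto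
  then show "k \<in> range (\<lambda>i. E (2 * i - s))"
  proof cases
    case 1
    then show ?thesis using E_0 by (intro image_eqI[of _ _ 0]) auto
  next
    case 2
    obtain t where t: "E t \<le> k" "k < E (Suc t)" using block_ex by blast
    have "k = E t"
    proof (rule ccontr)
      assume "k \<noteq> E t"
      then have "E t < k" using t(1) by simp
      from run_state_block(2)[OF assms this t(2)] 2 show False by (simp split: if_splits)
    qed
    then have "even (s + t)" using 2 run_state_block(1)[OF assms, of t] by (auto split: if_splits)
    then obtain i where "s + t = 2 * i" by (elim evenE)
    then show ?thesis using \<open>k = E t\<close> by (intro image_eqI[of _ _ i]) auto
  qed
next
  fix k assume "k \<in> range (\<lambda>i. E (2 * i - s))"
  then obtain i where i: "k = E (2 * i - s)" by blast
  show "k \<in> insert 0 {k. 1 \<le> k \<and> run_state d s w k = 2}"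
  proof (cases "i = 0")
    case True
    then show ?thesis using i E_0 by simp
  next
    case False
    then have "2 * i - s > 0" "even (s + (2 * i - s))" using assms by auto
    moreover from this have "E (2 * i - s) > 0" using E_less[of 0] E_0 by simp
    ultimately show ?thesis using i run_state_block(1)[OF assms, of "2 * i - s"] by simp
  qed
qed

lemma reset_mono: "s \<le> 1 \<Longrightarrow> strict_mono (\<lambda>i. E (2 * i - s))"
  by (auto simp: strict_mono_def)

definition parikh :: "nat \<Rightarrow> nat list" where
  "parikh t = map (\<lambda>j. \<Sum>n\<in>{E t..<E (Suc t)}. of_bool (w n = j)) [0..<d]"

text \<open>The chain encoded by the word. The shift by one provides the zero vector that the reader
  with initial state 1 sees as the old block before block 0.\<close>

definition history :: "nat \<Rightarrow> nat list" where
  "history t = (case t of 0 \<Rightarrow> replicate d 0 | Suc t \<Rightarrow> parikh t)"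

lemma history_simps [simp]: "history 0 = replicate d 0" "history (Suc t) = parikh t"
  by (simp_all add: history_def)

lemma length_history [simp]: "length (history t) = d"
  by (cases t) (simp_all add: parikh_def)

lemma block_weight:
  assumes "s \<le> 1" "j < 2 * d"
  shows "(\<Sum>n\<in>{E t..<E (Suc t)}. letter_weight d (run_state d s w n) (w n) ! j) =
    (if odd (s + t) then parikh t @ replicate d 0 else replicate d 0 @ parikh t) ! j"
proof -
  have "run_state d s w n = 1 \<longleftrightarrow> odd (s + t)" if "n \<in> {E t..<E (Suc t)}" for n
    using that run_state_block[OF assms(1), of t] run_state_block(2)[OF assms(1), of t n]
    by (cases "n = E t") auto
  then have "(\<Sum>n\<in>{E t..<E (Suc t)}. letter_weight d (run_state d s w n) (w n) ! j) =
      (\<Sum>n\<in>{E t..<E (Suc t)}. of_bool (w n < d \<and> j = (if odd (s + t) then w n else d + w n)))"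
    using assms(2) by (intro sum.cong) (simp_all add: letter_weight_def)
  also have "\<dots> = (if odd (s + t) then if j < d then parikh t ! j else 0
      else if j < d then 0 else parikh t ! (j - d))"
  proof -
    have "(\<Sum>n\<in>{E t..<E (Suc t)}. of_bool (w n < d \<and> j = w n)) = (if j < d then parikh t ! j else 0)"
      by (auto simp: parikh_def intro!: arg_cong[where f = card])
    moreover have "(\<Sum>n\<in>{E t..<E (Suc t)}. of_bool (w n < d \<and> j = d + w n)) =
        (if j < d then 0 else parikh t ! (j - d))"
      using assms(2) by (auto simp: parikh_def intro!: arg_cong[where f = card])
    ultimately show ?thesis by simp
  qed
  also have "\<dots> = (if odd (s + t) then parikh t @ replicate d 0 else replicate d 0 @ parikh t) ! j"
    using assms(2) by (auto simp: nth_append parikh_def)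
  finally show ?thesis .
qed

text \<open>A segment is an old block followed by a new one, but the new block owns the first
  \<open>d\<close> coordinates; hence the reversed order of the two vectors.\<close>

lemma segment_weight:
  assumes "s \<le> 1" "i \<ge> 1"
  shows "map (\<lambda>j. \<Sum>n\<in>{E (2 * (i - 1) - s)..<E (2 * i - s)}.
      letter_weight d (run_state d s w n) (w n) ! j) [0..<2 * d] =
    history (2 * i - s) @ history (2 * i - s - 1)"
    (is "map ?f _ = _")
proof (rule nth_equalityI)
  fix j assume "j < length (map ?f [0..<2 * d])"
  then have j: "j < 2 * d" by simp
  show "map ?f [0..<2 * d] ! j = (history (2 * i - s) @ history (2 * i - s - 1)) ! j"
  proof (cases "2 * i - s = 1")
    \<comment> \<open>The one short segment: the reader with initial state 1 resets right after
      block 0, which it reads as new, and the old half stays zero.\<close>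
    case True
    then have "s = 1" "i = 1" using assms by auto
    then show ?thesis using block_weight[of 1 j 0] j by simp
  next
    case False
    then have "2 \<le> 2 * i - s" using assms by linarith
    then obtain t where "2 * i - s = 2 + t" by (rule le_Suc_ex[THEN exE])
    then have t: "2 * i - s = Suc (Suc t)" by simp
    then have t': "2 * (i - 1) - s = t" "s + t = 2 * (i - 1)" using assms by linarith+
    have "?f j = (\<Sum>n\<in>{E t..<E (Suc t)}. letter_weight d (run_state d s w n) (w n) ! j) +
        (\<Sum>n\<in>{E (Suc t)..<E (Suc (Suc t))}. letter_weight d (run_state d s w n) (w n) ! j)"
      unfolding t t' by (rule sum.atLeastLessThan_concat[symmetric]) (simp_all add: less_imp_le)
    also have "\<dots> = (replicate d 0 @ parikh t) ! j + (parikh (Suc t) @ replicate d 0) ! j"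
    proof -
      have "even (s + t)" unfolding t'(2) by simp
      then show ?thesis by (simp add: block_weight[OF assms(1) j])
    qed
    also have "\<dots> = (parikh (Suc t) @ parikh t) ! j"
      using j by (auto simp: nth_append parikh_def)
    finally show ?thesis using j t by simp
  qed
qed simp

lemma SR_reader_blocks:
  assumes "s \<le> 1"
  shows "w \<in> SR (pa_of (reader d s L)) \<longleftrightarrow>
    (\<forall>i\<ge>1. history (2 * i - s) @ history (2 * i - s - 1) \<in> target (pa_of (reader d s L)))"
proof -
  have "infinite (insert 0 {k. 1 \<le> k \<and> run_state d s w k = 2})"
    unfolding resets[OF assms]
    using reset_mono[OF assms] strict_mono_imp_inj_on range_inj_infinite by blast
  then have inf: "infinite {k. 1 \<le> k \<and> run_state d s w k = 2}" by simp
  have "s \<le> 2" using assms by simp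
  show ?thesis
    unfolding SR_reader[OF \<open>s \<le> 2\<close>] resets[OF assms] enumerate_range[OF reset_mono[OF assms]]
    using inf letters segment_weight[OF assms] by auto
qed

text \<open>The steps at even \<open>t\<close> are checked by the reader with initial state 1, those
  at odd \<open>t\<close> by the other one.\<close>

lemma SR_both:
  "w \<in> SR (pa_of (reader d 0 L)) \<inter> SR (pa_of (reader d 1 L)) \<longleftrightarrow>
    (\<forall>t. history (Suc t) @ history t \<in> target (pa_of (reader d 0 L)))"
proof -
  have tgt: "target (pa_of (reader d s L)) = target (pa_of (reader d 0 L))" for s
    by (simp add: reader_simps)
  show ?thesis (is "?l \<longleftrightarrow> ?r")
  proof
    assume ?l
    then have *: "\<forall>i\<ge>1. history (2 * i) @ history (2 * i - 1) \<in> target (pa_of (reader d 0 L))"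
      "\<forall>i\<ge>1. history (2 * i - 1) @ history (2 * i - 1 - 1) \<in> target (pa_of (reader d 0 L))"
      using SR_reader_blocks[of 0] SR_reader_blocks[of 1] tgt[of 1] by auto
    show ?r
    proof
      fix t
      show "history (Suc t) @ history t \<in> target (pa_of (reader d 0 L))"
      proof (cases "even t")
        case True
        then obtain i where "t = 2 * i" by (elim evenE)
        then show ?thesis using *(2)[rule_format, of "Suc i"] by simp
      next
        case False
        then obtain i where "t = 2 * i + 1" by (elim oddE)
        then show ?thesis using *(1)[rule_format, of "Suc i"] by simp
      qed
    qed
  next
    assume r: ?r
    have *: "history m @ history (m - 1) \<in> target (pa_of (reader d 0 L))" if "m \<ge> 1" for m
      using that r by (cases m) auto
    have "w \<in> SR (pa_of (reader d s L))" if "s \<le> 1" for s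
      unfolding SR_reader_blocks[OF that] tgt[of s]
    proof (intro allI impI)
      fix i :: nat assume "1 \<le> i"
      then show "history (2 * i - s) @ history (2 * i - s - 1) \<in> target (pa_of (reader d 0 L))"
        using that by (intro *) simp
    qed
    from this[of 0] this[of 1] show ?l by simp
  qed
qed

end

section \<open>Words spelling a given sequence of vectors\<close>

lemma count_list_unary:
  "count_list (concat (map (\<lambda>j. replicate (f j) j) [0..<m])) k = (if k < m then f k else 0)"
proof -
  have rep: "count_list (replicate n x) k = (if x = k then n else 0)" for n x :: nat
    by (induction n) auto
  show ?thesis by (induction m) (auto simp: count_list_append rep)
qed

lemma sum_of_bool_nth: "(\<Sum>i<length xs. of_bool (xs ! i = x)) = count_list xs x"
  by (induction xs rule: rev_induct) (auto simp: nth_append count_list_append)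

text \<open>Each vector is spelled in unary, coordinate by coordinate, and closed by the separator.
  The separator makes even the block of the zero vector nonempty, so \<open>E\<close> is strictly
  increasing.\<close>

lemma blocks_of_history:
  assumes "\<And>t. length (V t) = d"
  obtains w E where "blocks d w E" "\<And>t. blocks.parikh d w E t = V t"
proof -
  define B where "B t = concat (map (\<lambda>j. replicate (V t ! j) j) [0..<d]) @ [d]" for t
  define P where "P t = concat (map B [0..<t])" for t
  define E where "E t = length (P t)" for t
  \<comment> \<open>All blocks are nonempty, so the first \<open>Suc n\<close> blocks already cover
    position \<open>n\<close>.\<close>
  define w where "w n = P (Suc n) ! n" for n
  have P_Suc: "P (Suc t) = P t @ B t" for t by (simp add: P_def)
  have E_Suc: "E (Suc t) = E t + length (B t)" for t by (simp add: E_def P_Suc)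
  have B_pos: "length (B t) > 0" for t by (simp add: B_def)
  have mono: "strict_mono E" unfolding strict_mono_Suc_iff using B_pos by (simp add: E_Suc)
  have prefix: "P u ! n = P t ! n" if "t \<le> u" "n < E t" for t u n
    using that(1)
  proof (induction u rule: dec_induct)
    case (step u)
    have "E t \<le> E u" using step mono by (simp add: strict_mono_less_eq)
    then show ?case using step that(2) by (simp add: P_Suc nth_append E_def)
  qed simp
  have w_P: "w n = P t ! n" if "n < E t" for n t
  proof -
    have "n < E (Suc n)" using strict_mono_imp_increasing[OF mono, of "Suc n"] by simp
    then show ?thesis using prefix[of t "Suc n" n] prefix[of "Suc n" t n] that
      by (cases "t \<le> Suc n") (auto simp: w_def)
  qed
  have w_B: "w (E t + i) = B t ! i" if "i < length (B t)" for t i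
    using w_P[of "E t + i" "Suc t"] that by (simp add: E_Suc P_Suc nth_append E_def)
  have find: "\<exists>t i. n = E t + i \<and> i < length (B t)" for n
  proof (induction n)
    case 0
    show ?case using B_pos by (intro exI[of _ 0]) (simp add: E_def P_def)
  next
    case (Suc n)
    then obtain t i where ti: "n = E t + i" "i < length (B t)" by blast
    show ?case
    proof (cases "Suc i < length (B t)")
      case True
      then show ?thesis using ti by (intro exI[of _ t] exI[of _ "Suc i"]) simp
    next
      case False
      then show ?thesis using ti B_pos by (intro exI[of _ "Suc t"] exI[of _ 0]) (simp add: E_Suc)
    qed
  qed
  have B_nth: "B t ! i \<le> d" "B t ! i = d \<longleftrightarrow> Suc i = length (B t)" if "i < length (B t)" for t i
  proof -
    let ?u = "concat (map (\<lambda>j. replicate (V t ! j) j) [0..<d])"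
    have "B t ! i < d" if "i < length ?u"
    proof -
      have "?u ! i \<in> set ?u" using that by (rule nth_mem)
      then show ?thesis using that by (auto simp: B_def nth_append)
    qed
    then show "B t ! i \<le> d" "B t ! i = d \<longleftrightarrow> Suc i = length (B t)"
      using \<open>i < length (B t)\<close> by (cases "i < length ?u"; force simp: B_def nth_append)+
  qed
  have blk: "blocks d w E"
  proof
    show "w n \<le> d" for n using find[of n] w_B B_nth(1) by metis
    show "strict_mono E" by (rule mono)
    show "range E = insert 0 {Suc n | n. w n = d}"
    proof (intro set_eqI iffI)
      fix k assume "k \<in> range E"
      then obtain t where t: "k = E t" by blast
      show "k \<in> insert 0 {Suc n | n. w n = d}"
      proof (cases t)
        case 0
        then show ?thesis using t by (simp add: E_def P_def)
      next
        case (Suc u)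
        obtain l where l: "length (B u) = Suc l" using B_pos[of u] gr0_implies_Suc by blast
        then have "k = Suc (E u + l)" using t Suc by (simp add: E_Suc)
        moreover have "w (E u + l) = d"
          using w_B[of l u] B_nth(2)[of l u] l by simp
        ultimately show ?thesis by blast
      qed
    next
      fix k assume "k \<in> insert 0 {Suc n | n. w n = d}"
      then consider "k = 0" | n where "k = Suc n" "w n = d" by blast
      then show "k \<in> range E"
      proof cases
        case 1
        then show ?thesis by (intro image_eqI[of _ _ 0]) (simp_all add: E_def P_def)
      next
        case 2
        obtain t i where ti: "n = E t + i" "i < length (B t)" using find by blast
        then have "Suc i = length (B t)" using 2 w_B B_nth(2) by metis
        then show ?thesis using 2 ti by (intro image_eqI[of _ _ "Suc t"]) (simp_all add: E_Suc)
      qed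
    qed
  qed
  have "blocks.parikh d w E t = V t" for t
  proof (rule nth_equalityI)
    show len: "length (blocks.parikh d w E t) = length (V t)"
      using assms by (simp add: blocks.parikh_def[OF blk])
    fix j assume "j < length (blocks.parikh d w E t)"
    then have j: "j < d" using len assms by simp
    have "(\<Sum>n\<in>{E t..<E (Suc t)}. of_bool (w n = j)) = (\<Sum>i<length (B t). of_bool (w (E t + i) = j))"
      using sum.atLeastLessThan_shift_0[of "\<lambda>n. of_bool (w n = j)" "E t" "E (Suc t)"]
      by (simp add: E_Suc atLeast0LessThan add.commute)
    also have "\<dots> = (\<Sum>i<length (B t). of_bool (B t ! i = j))"
      by (intro sum.cong) (simp_all add: w_B)
    also have "\<dots> = count_list (B t) j" by (rule sum_of_bool_nth)
    also have "\<dots> = V t ! j"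
      using j by (simp add: B_def count_list_append count_list_unary)
    finally show "blocks.parikh d w E t ! j = V t ! j"
      using j by (simp add: blocks.parikh_def[OF blk])
  qed
  with blk show ?thesis using that by blast
qed

lemma SR_reader_nonempty:
  "SR (pa_of (reader d 0 L)) \<inter> SR (pa_of (reader d 1 L)) \<noteq> {} \<longleftrightarrow>
    (\<exists>V. V 0 = replicate d 0 \<and> (\<forall>t. length (V t) = d) \<and>
      (\<forall>t. V (Suc t) @ V t \<in> target (pa_of (reader d 0 L))))"
proof
  assume "SR (pa_of (reader d 0 L)) \<inter> SR (pa_of (reader d 1 L)) \<noteq> {}"
  then obtain w where w: "w \<in> SR (pa_of (reader d 0 L)) \<inter> SR (pa_of (reader d 1 L))" by blast
  then have le: "w i \<le> d" for i
    using SR_reader[of 0] by auto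
  from w have inf: "infinite {k. 1 \<le> k \<and> run_state d 0 w k = 2}"
    using SR_reader[of 0] by auto
  let ?S = "insert 0 {Suc n | n. w n = d}"
  \<comment> \<open>State 2 is entered by reading a separator only, so infinitely many resets force
    infinitely many blocks.\<close>
  have "{k. 1 \<le> k \<and> run_state d 0 w k = 2} \<subseteq> ?S"
  proof
    fix k assume "k \<in> {k. 1 \<le> k \<and> run_state d 0 w k = 2}"
    then obtain n where "k = Suc n" "next_state d (run_state d 0 w n) (w n) = 2"
      by (cases k) auto
    then show "k \<in> ?S" using le[of n] by (auto simp: next_state_def split: if_splits)
  qed
  then have S: "infinite ?S" using inf infinite_super by blast
  interpret blocks d w "enumerate ?S"
    by unfold_locales (use le strict_mono_enumerate[OF S] range_enumerate[OF S] in auto)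
  show "\<exists>V. V 0 = replicate d 0 \<and> (\<forall>t. length (V t) = d) \<and>
      (\<forall>t. V (Suc t) @ V t \<in> target (pa_of (reader d 0 L)))"
    using w[unfolded SR_both] by (intro exI[of _ history]) auto
next
  assume "\<exists>V. V 0 = replicate d 0 \<and> (\<forall>t. length (V t) = d) \<and>
      (\<forall>t. V (Suc t) @ V t \<in> target (pa_of (reader d 0 L)))"
  then obtain V where V: "V 0 = replicate d 0" "\<And>t. length (V t) = d"
    "\<And>t. V (Suc t) @ V t \<in> target (pa_of (reader d 0 L))" by blast
  \<comment> \<open>The word spells \<open>V 1\<close>, \<open>V 2\<close> and so on; the zero
    vector \<open>V 0\<close> is the empty history before the first block.\<close>
  obtain w E where wE: "blocks d w E" "\<And>t. blocks.parikh d w E t = V (Suc t)"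
    using blocks_of_history[of "\<lambda>t. V (Suc t)" d] V(2) by blast
  interpret blocks d w E by (rule wE(1))
  have "history t = V t" for t
    using wE(2) V(1) by (cases t) simp_all
  then have "w \<in> SR (pa_of (reader d 0 L)) \<inter> SR (pa_of (reader d 1 L))"
    unfolding SR_both using V(3) by simp
  then show "SR (pa_of (reader d 0 L)) \<inter> SR (pa_of (reader d 1 L)) \<noteq> {}" by blast
qed

section \<open>Counter machines as chains of vectors\<close>

text \<open>Distinct parameters may have equal period vectors, which a set of periods merges. Merged
  multipliers are added up; conversely, a single multiplier is given to one representative index and
  0 to the others.\<close>

lemma linear_set_list:
  "linear_set D b (set ps) = {map (\<lambda>j. b ! j + (\<Sum>k<length ps. ps ! k ! j * z k)) [0..<D] | z. True}"
    (is "_ = ?R")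
proof (intro equalityI subsetI)
  fix x assume "x \<in> linear_set D b (set ps)"
  then obtain z where x: "x = map (\<lambda>j. b ! j + (\<Sum>p\<in>set ps. p ! j * z p)) [0..<D]"
    by (auto simp: linear_set_def)
  \<comment> \<open>\<open>K\<close> will contain exactly one index for each distinct
    period.\<close>
  have "set ps = (!) ps ` {..<length ps}" by (auto simp: set_conv_nth)
  then obtain K where K: "K \<subseteq> {..<length ps}" "inj_on ((!) ps) K" "set ps = (!) ps ` K"
    by (metis order_refl subset_image_inj)
  define y where "y k = (if k \<in> K then z (ps ! k) else 0)" for k
  have "(\<Sum>p\<in>set ps. p ! j * z p) = (\<Sum>k<length ps. ps ! k ! j * y k)" for j
  proof -
    have "(\<Sum>p\<in>set ps. p ! j * z p) = (\<Sum>k\<in>K. ps ! k ! j * z (ps ! k))"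
      unfolding K(3) by (rule sum.reindex_cong[OF K(2)]) auto
    also have "\<dots> = (\<Sum>k<length ps. ps ! k ! j * y k)"
      using K(1) by (intro sum.mono_neutral_cong_left) (auto simp: y_def)
    finally show ?thesis .
  qed
  then show "x \<in> ?R" using x by auto
next
  fix x assume "x \<in> ?R"
  then obtain z where x: "x = map (\<lambda>j. b ! j + (\<Sum>k<length ps. ps ! k ! j * z k)) [0..<D]" by auto
  define y where "y p = (\<Sum>k | k < length ps \<and> ps ! k = p. z k)" for p
  have "(\<Sum>p\<in>set ps. p ! j * y p) = (\<Sum>k<length ps. ps ! k ! j * z k)" for j
  proof -
    have "(\<Sum>p\<in>set ps. p ! j * y p) =
        (\<Sum>p\<in>set ps. \<Sum>k | k \<in> {..<length ps} \<and> ps ! k = p. ps ! k ! j * z k)"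
      unfolding y_def by (intro sum.cong refl) (auto simp: sum_distrib_left intro!: sum.cong)
    also have "\<dots> = (\<Sum>k<length ps. ps ! k ! j * z k)"
      by (rule sum.group) auto
    finally show ?thesis .
  qed
  then have "x = map (\<lambda>j. b ! j + (\<Sum>p\<in>set ps. p ! j * y p)) [0..<D]" unfolding x by simp
  then show "x \<in> linear_set D b (set ps)" unfolding linear_set_def by blast
qed

type_synonym side = "nat \<Rightarrow> nat option \<times> nat"

definition side_base :: "nat \<Rightarrow> side \<Rightarrow> nat list" where
  "side_base d a = map (\<lambda>i. snd (a i)) [0..<d]"

definition side_period :: "nat \<Rightarrow> nat \<Rightarrow> side \<Rightarrow> nat list" where
  "side_period d k a = map (\<lambda>i. of_bool (fst (a i) = Some k)) [0..<d]"

text \<open>One period per parameter. The target side precedes the source side, as the new block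
  precedes the old one in the weights of \<open>reader\<close>.\<close>

definition step_linear :: "nat \<Rightarrow> action \<Rightarrow> nat list \<times> nat list list" where
  "step_linear d a = (side_base d (snd a) @ side_base d (fst a),
     map (\<lambda>k. side_period d k (snd a) @ side_period d k (fst a)) [0..<d])"

definition step_set :: "nat \<Rightarrow> action \<Rightarrow> nat list set" where
  "step_set d a = (case step_linear d a of (b, ps) \<Rightarrow> linear_set (2 * d) b (set ps))"

lemma side_val:
  assumes "i < d" "\<And>k. fst (a i) = Some k \<Longrightarrow> k < d"
  shows "side_base d a ! i + (\<Sum>k<d. side_period d k a ! i * z k) = val z (a i)"
proof (cases "fst (a i)")
  case (Some l)
  then have "(\<Sum>k<d. side_period d k a ! i * z k) = (\<Sum>k<d. if k = l then z k else 0)"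
    using assms(1) by (intro sum.cong) (auto simp: side_period_def)
  also have "\<dots> = z l" using assms(2)[OF Some] by simp
  finally show ?thesis using assms(1) Some by (simp add: side_base_def val_def)
qed (use assms(1) in \<open>simp add: side_base_def side_period_def val_def\<close>)

text \<open>The multipliers of the linear set are the values of the parameters; the bound on the
  parameters ensures that the \<open>d\<close> periods account for all that occur.\<close>

lemma step_set_iff:
  assumes "length u = d" "length v = d"
    and bnd: "\<And>i k. i < d \<Longrightarrow> fst (fst a i) = Some k \<or> fst (snd a i) = Some k \<Longrightarrow> k < d"
  shows "u @ v \<in> step_set d a \<longleftrightarrow> (\<exists>z. \<forall>i<d. v ! i = val z (fst a i) \<and> u ! i = val z (snd a i))"
proof -
  have "map (\<lambda>j. fst (step_linear d a) ! j +
        (\<Sum>k<length (snd (step_linear d a)). snd (step_linear d a) ! k ! j * z k)) [0..<2 * d] =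
      map (\<lambda>i. val z (snd a i)) [0..<d] @ map (\<lambda>i. val z (fst a i)) [0..<d]" (is "?l = ?r") for z
  proof (rule nth_equalityI)
    fix j assume "j < length ?l"
    then have j: "j < 2 * d" by simp
    have len: "length (side_base d b) = d" "length (side_period d k b) = d" for b k
      by (simp_all add: side_base_def side_period_def)
    show "?l ! j = ?r ! j"
    proof (cases "j < d")
      case True
      then have "?l ! j = side_base d (snd a) ! j + (\<Sum>k<d. side_period d k (snd a) ! j * z k)"
        using j by (simp add: step_linear_def nth_append len)
      also have "\<dots> = val z (snd a j)" using True bnd by (intro side_val) auto
      finally show ?thesis using True by (simp add: nth_append)
    next
      case False
      then have "?l ! j = side_base d (fst a) ! (j - d) + (\<Sum>k<d. side_period d k (fst a) ! (j - d) * z k)"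
        using j by (simp add: step_linear_def nth_append len)
      also have "\<dots> = val z (fst a (j - d))"
      proof (rule side_val)
        show "j - d < d" using False j by simp
        then show "k < d" if "fst (fst a (j - d)) = Some k" for k using bnd that by blast
      qed
      finally show ?thesis using False j less_diff_conv2[of d j d] by (simp add: nth_append)
    qed
  qed simp
  then have "u @ v \<in> step_set d a \<longleftrightarrow>
      (\<exists>z. u @ v = map (\<lambda>i. val z (snd a i)) [0..<d] @ map (\<lambda>i. val z (fst a i)) [0..<d])"
    by (simp add: step_set_def linear_set_list case_prod_beta)
  also have "\<dots> \<longleftrightarrow> (\<exists>z. \<forall>i<d. v ! i = val z (fst a i) \<and> u ! i = val z (snd a i))"
  proof -
    have map_iff: "x = map g [0..<d] \<longleftrightarrow> (\<forall>i<d. x ! i = g i)" if "length x = d" for x g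
      using that by (simp add: list_eq_iff_nth_eq)
    show ?thesis
      using assms(1,2) by (simp add: append_eq_append_conv map_iff) blast
  qed
  finally show ?thesis .
qed

text \<open>Coordinate \<open>N\<close> is the control state and coordinate \<open>Suc N\<close> is a fuel counter, guessed initially,
  which every edge decrements. Only the step at the halting state preserves it, so an infinite
  chain has to reach that state. Control states are positive, hence the initial step applies to
  the zero vector only.\<close>

definition edge_action :: "nat \<Rightarrow> edge \<Rightarrow> action" where
  "edge_action N e = (case e of (p, a, q) \<Rightarrow>
     ((fst a)(N := (None, p), Suc N := (Some (Suc N), 1)),
      (snd a)(N := (None, q), Suc N := (Some (Suc N), 0))))"

definition halt_action :: "nat \<Rightarrow> nat \<Rightarrow> action" where
  "halt_action N t = (keep(N := (None, t)), keep(N := (None, t)))"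

definition init_side :: "nat \<Rightarrow> nat list \<Rightarrow> side" where
  "init_side N ns i = (if i < length ns then (None, ns ! i) else if i = N then (None, 1)
     else if i = Suc N then (Some (Suc N), 0) else (None, 0))"

definition init_action :: "nat \<Rightarrow> nat list \<Rightarrow> action" where
  "init_action N ns = (\<lambda>_. (None, 0), init_side N ns)"

definition config :: "nat \<Rightarrow> nat \<Rightarrow> store \<Rightarrow> nat \<Rightarrow> nat list" where
  "config N p \<sigma> f = map \<sigma> [0..<N] @ [p, f]"

definition store_of :: "nat \<Rightarrow> nat list \<Rightarrow> store" where
  "store_of N v i = (if i < N then v ! i else 0)"

lemma config_simps [simp]:
  "length (config N p \<sigma> f) = Suc (Suc N)"
  "i < N \<Longrightarrow> config N p \<sigma> f ! i = \<sigma> i"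
  "config N p \<sigma> f ! N = p"
  "config N p \<sigma> f ! Suc N = f"
  by (simp_all add: config_def nth_append)

lemma all_less_Suc_Suc: "(\<forall>i<Suc (Suc N). P i) \<longleftrightarrow> (\<forall>i<N. P i) \<and> P N \<and> P (Suc N)"
  by (auto simp: less_Suc_eq)

context
  fixes N :: nat and u v :: "nat list"
  assumes u: "length u = Suc (Suc N)" and v: "length v = Suc (Suc N)"
begin

lemma edge_step_iff:
  assumes "act_bound N a"
  shows "u @ v \<in> step_set (Suc (Suc N)) (edge_action N (p, a, q)) \<longleftrightarrow>
    v ! N = p \<and> u ! N = q \<and> v ! Suc N = Suc (u ! Suc N) \<and> (store_of N v, store_of N u) \<in> act_rel a"
proof -
  have bnd: "\<And>i k. i < N \<Longrightarrow> fst (fst a i) = Some k \<or> fst (snd a i) = Some k \<Longrightarrow> k < N"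
    and out: "\<And>i. i \<ge> N \<Longrightarrow> fst a i = keep i \<and> snd a i = keep i"
    using assms unfolding act_bound_def by blast+
  \<comment> \<open>Terms of registers below \<open>N\<close> mention parameters below
    \<open>N\<close> only, so the fuel parameter \<open>Suc N\<close> can be reset without affecting
    them.\<close>
  have local: "val z (fst a i) = val y (fst a i)" "val z (snd a i) = val y (snd a i)"
    if "\<forall>i<N. z i = y i" "i < N" for z y i
    using bnd[OF that(2)] that(1) by (auto simp: val_def split: option.splits)
  have "u @ v \<in> step_set (Suc (Suc N)) (edge_action N (p, a, q)) \<longleftrightarrow>
    (\<exists>z. (\<forall>i<N. v ! i = val z (fst a i) \<and> u ! i = val z (snd a i)) \<and>
      v ! N = p \<and> u ! N = q \<and> v ! Suc N = Suc (z (Suc N)) \<and> u ! Suc N = z (Suc N))"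
  proof (subst step_set_iff[OF u v])
    fix i k
    assume "i < Suc (Suc N)" "fst (fst (edge_action N (p, a, q)) i) = Some k \<or>
      fst (snd (edge_action N (p, a, q)) i) = Some k"
    then show "k < Suc (Suc N)"
      using bnd[of i k] by (auto simp: edge_action_def less_Suc_eq split: if_splits)
  qed (auto simp: all_less_Suc_Suc edge_action_def)
  also have "\<dots> \<longleftrightarrow> v ! N = p \<and> u ! N = q \<and> v ! Suc N = Suc (u ! Suc N) \<and>
      (\<exists>z. \<forall>i<N. v ! i = val z (fst a i) \<and> u ! i = val z (snd a i))" (is "?l \<longleftrightarrow> ?r")
  proof
    assume ?r
    then obtain z where z: "\<forall>i<N. v ! i = val z (fst a i) \<and> u ! i = val z (snd a i)" by blast
    show ?l
      using \<open>?r\<close> z local[of z "z(Suc N := u ! Suc N)"]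
      by (intro exI[of _ "z(Suc N := u ! Suc N)"]) simp
  qed auto
  also have "(\<exists>z. \<forall>i<N. v ! i = val z (fst a i) \<and> u ! i = val z (snd a i)) \<longleftrightarrow>
      (store_of N v, store_of N u) \<in> act_rel a" (is "?l \<longleftrightarrow> ?r")
  proof
    assume ?l
    then obtain z where z: "\<forall>i<N. v ! i = val z (fst a i) \<and> u ! i = val z (snd a i)" by blast
    \<comment> \<open>\<open>store_of\<close> is 0 from \<open>N\<close> on, where the action copies
      the parameters; these must therefore be 0 too.\<close>
    define y where "y i = (if i < N then z i else 0)" for i
    have "store_of N v i = val y (fst a i) \<and> store_of N u i = val y (snd a i)" for i
      using z local[of z y i] out[of i] by (cases "i < N") (auto simp: store_of_def y_def)
    then show ?r unfolding act_rel_def by (auto simp: fun_eq_iff)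
  next
    assume ?r
    then obtain z where "store_of N v = (\<lambda>i. val z (fst a i))" "store_of N u = (\<lambda>i. val z (snd a i))"
      unfolding act_rel_def by blast
    then have "\<forall>i<N. v ! i = val z (fst a i) \<and> u ! i = val z (snd a i)"
      by (metis store_of_def)
    then show ?l by blast
  qed
  finally show ?thesis .
qed

lemma halt_step_iff:
  "u @ v \<in> step_set (Suc (Suc N)) (halt_action N t) \<longleftrightarrow> v ! N = t \<and> u = v"
proof -
  have "u @ v \<in> step_set (Suc (Suc N)) (halt_action N t) \<longleftrightarrow>
    (\<exists>z. (\<forall>i<N. v ! i = z i \<and> u ! i = z i) \<and> v ! N = t \<and> u ! N = t \<and>
      v ! Suc N = z (Suc N) \<and> u ! Suc N = z (Suc N))"
  proof (subst step_set_iff[OF u v])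
    fix i k
    assume "i < Suc (Suc N)" "fst (fst (halt_action N t) i) = Some k \<or>
      fst (snd (halt_action N t) i) = Some k"
    then show "k < Suc (Suc N)" by (auto simp: halt_action_def keep_def split: if_splits)
  qed (auto simp: all_less_Suc_Suc halt_action_def)
  also have "\<dots> \<longleftrightarrow> v ! N = t \<and> u = v"
    using u v by (auto simp: list_eq_iff_nth_eq all_less_Suc_Suc intro!: exI[of _ "(!) v"])
  finally show ?thesis .
qed

lemma init_step_iff:
  assumes "length ns \<le> N"
  shows "u @ v \<in> step_set (Suc (Suc N)) (init_action N ns) \<longleftrightarrow>
    v = replicate (Suc (Suc N)) 0 \<and> u = config N 1 (store_of (length ns) ns) (u ! Suc N)"
proof -
  have "u @ v \<in> step_set (Suc (Suc N)) (init_action N ns) \<longleftrightarrow>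
    (\<exists>z. \<forall>i<Suc (Suc N). v ! i = 0 \<and> u ! i = val z (init_side N ns i))"
  proof (subst step_set_iff[OF u v])
    fix i k
    assume "fst (fst (init_action N ns) i) = Some k \<or> fst (snd (init_action N ns) i) = Some k"
    then show "k < Suc (Suc N)" by (auto simp: init_action_def init_side_def split: if_splits)
  qed (auto simp: init_action_def)
  also have "\<dots> \<longleftrightarrow> (\<forall>i<Suc (Suc N). v ! i = 0) \<and>
      (\<forall>i<N. u ! i = store_of (length ns) ns i) \<and> u ! N = 1"
    using assms unfolding all_less_Suc_Suc
    by (auto simp: init_side_def store_of_def intro!: exI[of _ "\<lambda>_. u ! Suc N"])
  also have "\<dots> \<longleftrightarrow> v = replicate (Suc (Suc N)) 0 \<and>
      u = config N 1 (store_of (length ns) ns) (u ! Suc N)"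
  proof -
    have "(\<forall>i<Suc (Suc N). v ! i = 0) \<longleftrightarrow> v = replicate (Suc (Suc N)) 0"
      using v by (simp add: list_eq_iff_nth_eq del: replicate_Suc)
    moreover have "(\<forall>i<N. u ! i = \<sigma> i) \<and> u ! N = p \<longleftrightarrow> u = config N p \<sigma> (u ! Suc N)" for \<sigma> p
      using u by (simp add: list_eq_iff_nth_eq[of u] all_less_Suc_Suc)
    ultimately show ?thesis by simp
  qed
  finally show ?thesis .
qed

end

section \<open>Infinite chains and halting runs\<close>

lemma no_infinite_descent: "\<exists>k. \<not> f (Suc k) < (f k :: nat)"
proof (rule ccontr)
  assume "\<nexists>k. \<not> f (Suc k) < f k"
  then have less: "f (Suc k) < f k" for k by blast
  have "f k + k \<le> f 0" for k
  proof (induction k)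
    case (Suc k)
    then show ?case using less[of k] by simp
  qed simp
  from this[of "Suc (f 0)"] show False by simp
qed

lemma chain_iff:
  assumes prog: "program (set es) 1 t R" and bnd: "\<forall>(p, a, q) \<in> set es. act_bound N a"
    and ns: "length ns \<le> N"
  defines "acts \<equiv> init_action N ns # halt_action N t # map (edge_action N) es"
  shows "(\<exists>V. V 0 = replicate (Suc (Suc N)) 0 \<and> (\<forall>k. length (V k) = Suc (Suc N)) \<and>
      (\<forall>k. V (Suc k) @ V k \<in> (\<Union>a\<in>set acts. step_set (Suc (Suc N)) a))) \<longleftrightarrow>
    (\<exists>\<tau>. (store_of (length ns) ns, \<tau>) \<in> R)" (is "?l \<longleftrightarrow> ?r")
proof -
  let ?d = "Suc (Suc N)" and ?\<sigma> = "store_of (length ns) ns"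
  have reach: "((1, \<sigma>), (t, \<tau>)) \<in> (moves (set es))\<^sup>* \<longleftrightarrow> (\<sigma>, \<tau>) \<in> R" for \<sigma> \<tau>
    using prog unfolding program_def by blast
  have pos: "1 \<le> p" "1 \<le> q" if "(p, a, q) \<in> set es" for p a q
    using prog that unfolding program_def by blast+
  have t: "1 < t" using prog unfolding program_def by blast
  have bound: "act_bound N a" if "(p, a, q) \<in> set es" for p a q using bnd that by blast
  show ?thesis
  proof
    assume ?l
    then obtain V where V0: "V 0 = replicate ?d 0" and len: "\<And>k. length (V k) = ?d"
      and V: "\<And>k. V (Suc k) @ V k \<in> (\<Union>a\<in>set acts. step_set ?d a)" by blast
    have cases: "(V k = replicate ?d 0 \<and> V (Suc k) = config N 1 ?\<sigma> (V (Suc k) ! Suc N)) \<or>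
        (V k ! N = t \<and> V (Suc k) = V k) \<or>
        (\<exists>p a q. (p, a, q) \<in> set es \<and> V k ! N = p \<and> V (Suc k) ! N = q \<and>
          V k ! Suc N = Suc (V (Suc k) ! Suc N) \<and> (store_of N (V k), store_of N (V (Suc k))) \<in> act_rel a)"
      for k
    proof -
      obtain a where a: "a \<in> set acts" "V (Suc k) @ V k \<in> step_set ?d a" using V by blast
      then consider "a = init_action N ns" | "a = halt_action N t"
        | e where "e \<in> set es" "a = edge_action N e" by (auto simp: acts_def)
      then show ?thesis
      proof cases
        case 1
        then show ?thesis using a(2) init_step_iff[OF len len ns] by blast
      next
        case 2
        then show ?thesis using a(2) halt_step_iff[OF len len] by blast
      next
        case 3
        obtain p b q where e: "e = (p, b, q)" by (cases e) blast
        then show ?thesis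
          using 3 a(2) edge_step_iff[OF len len bound[of p b q], of "Suc k" k p q] by blast
      qed
    qed
    have zero: "V k ! N = 0" if "V k = replicate ?d 0" for k
      unfolding that by (simp del: replicate_Suc)
    have inv: "1 \<le> V (Suc k) ! N \<and>
        ((1, ?\<sigma>), (V (Suc k) ! N, store_of N (V (Suc k)))) \<in> (moves (set es))\<^sup>*" for k
    proof (induction k)
      case 0
      have "V 0 ! N = 0" using zero[OF V0] .
      \<comment> \<open>The control coordinate is 0 here, while edges start at positive states and
        \<open>t\<close> exceeds 1; only the initial step is left.\<close>
      then have "V (Suc 0) = config N 1 ?\<sigma> (V (Suc 0) ! Suc N)"
        using cases[of 0] pos(1) t by (metis not_one_le_zero not_less0)
      then obtain f where f: "V (Suc 0) = config N 1 ?\<sigma> f" by blast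
      have "store_of N (config N 1 ?\<sigma> f) = ?\<sigma>" using ns by (auto simp: store_of_def)
      then show ?case unfolding f by simp
    next
      case (Suc k)
      consider "V (Suc (Suc k)) = V (Suc k)"
        | p a q where "(p, a, q) \<in> set es" "V (Suc k) ! N = p" "V (Suc (Suc k)) ! N = q"
          "(store_of N (V (Suc k)), store_of N (V (Suc (Suc k)))) \<in> act_rel a"
        using cases[of "Suc k"] Suc zero[of "Suc k"] by auto
      then show ?case
      proof cases
        case 1
        then show ?thesis using Suc by simp
      next
        case 2
        then have "((V (Suc k) ! N, store_of N (V (Suc k))),
            (V (Suc (Suc k)) ! N, store_of N (V (Suc (Suc k))))) \<in> moves (set es)"
          by (auto intro: movesI)
        then show ?thesis using Suc 2(1,3) pos(2) by (blast intro: rtrancl.rtrancl_into_rtrancl)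
      qed
    qed
    \<comment> \<open>Fuel cannot decrease forever. A step that does not decrease it is no edge, and
      it is not the initial step because the control state is positive by \<open>inv\<close>; so it
      is the halting step.\<close>
    obtain k where k: "\<not> V (Suc (Suc k)) ! Suc N < V (Suc k) ! Suc N"
      using no_infinite_descent[of "\<lambda>k. V (Suc k) ! Suc N"] by blast
    then have "V (Suc k) ! N = t"
      using cases[of "Suc k"] inv[of k] zero[of "Suc k"] by auto
    then show ?r using inv[of k] reach by auto
  next
    assume ?r
    then obtain \<tau> where "((1, ?\<sigma>), (t, \<tau>)) \<in> (moves (set es))\<^sup>*" using reach by blast
    then obtain n where "((1, ?\<sigma>), (t, \<tau>)) \<in> moves (set es) ^^ n"
      using rtrancl_imp_relpow by blast
    then obtain c where c: "c 0 = (1, ?\<sigma>)" "c n = (t, \<tau>)"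
      "\<And>i. i < n \<Longrightarrow> (c i, c (Suc i)) \<in> moves (set es)"
      unfolding relpow_fun_conv by blast
    \<comment> \<open>The guessed fuel is the length \<open>n\<close> of the halting run. From time
      \<open>n\<close> on, \<open>min k n\<close> freezes the last configuration and the truncated
      \<open>n - k\<close> stays 0.\<close>
    define V where "V k = (case k of 0 \<Rightarrow> replicate ?d 0
      | Suc k \<Rightarrow> config N (fst (c (min k n))) (snd (c (min k n))) (n - k))" for k
    have V0: "V 0 = replicate ?d 0"
      and VS: "V (Suc k) = config N (fst (c (min k n))) (snd (c (min k n))) (n - k)" for k
      by (simp_all add: V_def)
    have len: "length (V k) = ?d" for k by (cases k) (simp_all add: V0 VS)
    have "V (Suc k) @ V k \<in> (\<Union>a\<in>set acts. step_set ?d a)" for k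
    proof (cases k)
      case 0
      have "V 1 = config N 1 ?\<sigma> n" using VS[of 0] by (simp add: c(1))
      then have "V 1 @ V 0 \<in> step_set ?d (init_action N ns)"
        unfolding init_step_iff[OF len len ns] using V0 by simp
      then show ?thesis using 0 by (auto simp: acts_def)
    next
      case (Suc m)
      show ?thesis
      proof (cases "m < n")
        case True
        obtain p \<rho> q \<kappa> where pq: "c m = (p, \<rho>)" "c (Suc m) = (q, \<kappa>)" by fastforce
        then obtain a where a: "(p, a, q) \<in> set es" "(\<rho>, \<kappa>) \<in> act_rel a"
          using c(3)[OF True] movesE by metis
        have Vm: "V (Suc m) = config N p \<rho> (n - m)" "V (Suc (Suc m)) = config N q \<kappa> (n - Suc m)"
          using True pq by (simp_all add: VS min_def)
        obtain z where z: "\<rho> = (\<lambda>i. val z (fst a i))" "\<kappa> = (\<lambda>i. val z (snd a i))"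
          using a(2) unfolding act_rel_def by blast
        have "(store_of N (V (Suc m)), store_of N (V (Suc (Suc m)))) \<in> act_rel a"
        proof -
          \<comment> \<open>The chain remembers only the first \<open>N\<close> registers of each
            store, so the valuation is cut off in the same way.\<close>
          define y where "y i = (if i < N then z i else 0)" for i
          have b: "\<And>i k. i < N \<Longrightarrow> fst (fst a i) = Some k \<or> fst (snd a i) = Some k \<Longrightarrow> k < N"
            "\<And>i. i \<ge> N \<Longrightarrow> fst a i = keep i \<and> snd a i = keep i"
            using bound[OF a(1)] unfolding act_bound_def by blast+
          have "val z (fst a i) = val y (fst a i)" "val z (snd a i) = val y (snd a i)" if "i < N" for i
            using b(1)[OF that] by (auto simp: val_def y_def split: option.splits)
          then have "store_of N (V (Suc m)) i = val y (fst a i) \<and>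
              store_of N (V (Suc (Suc m))) i = val y (snd a i)" for i
            using b(2)[of i] unfolding Vm by (cases "i < N") (auto simp: store_of_def z y_def)
          then show ?thesis unfolding act_rel_def by (auto simp: fun_eq_iff)
        qed
        then have "V (Suc (Suc m)) @ V (Suc m) \<in> step_set ?d (edge_action N (p, a, q))"
          unfolding edge_step_iff[OF len len bound[OF a(1)]] using True by (simp add: Vm)
        then show ?thesis using a(1) Suc by (fastforce simp: acts_def)
      next
        case False
        then have "V (Suc (Suc m)) = V (Suc m)" "V (Suc m) ! N = t"
          using c(2) by (simp_all add: VS min_def)
        then have "V (Suc (Suc m)) @ V (Suc m) \<in> step_set ?d (halt_action N t)"
          unfolding halt_step_iff[OF len len] by simp
        then show ?thesis using Suc by (auto simp: acts_def)
      qed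
    qed
    with V0 len show ?l by blast
  qed
qed

section \<open>Diagonalization\<close>

lemma computes_Comp1:
  "computes g xs a \<Longrightarrow> computes f [a] y \<Longrightarrow> computes (Comp f [g]) xs y"
  by (rule computes.comp[of "[a]"]) auto

lemma computes_Comp2:
  "computes g xs a \<Longrightarrow> computes h xs b \<Longrightarrow> computes f [a, b] y \<Longrightarrow> computes (Comp f [g, h]) xs y"
  by (rule computes.comp[of "[a, b]"]) (auto simp: less_Suc_eq)

lemma computes_Proj: "i < length xs \<Longrightarrow> y = xs ! i \<Longrightarrow> computes (Proj i) xs y"
  using computes.proj by simp

definition add_recf :: recf where
  "add_recf = PrimRec (Proj 0) (Comp Succ [Proj 1])"

lemma computes_add: "computes add_recf [m, n] (m + n)"
  unfolding add_recf_def
proof (induction m)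
  case 0
  show ?case by (auto intro!: computes.prim_0 computes_Proj)
next
  case (Suc m)
  then show ?case
    by (rule computes.prim_Suc) (auto intro!: computes_Comp1[of _ _ "m + n"] computes_Proj computes.succ)
qed

definition triangle_recf :: recf where
  "triangle_recf = PrimRec Zero (Comp add_recf [Comp Succ [Proj 0], Proj 1])"

lemma computes_triangle: "computes triangle_recf [n] (triangle n)"
  unfolding triangle_recf_def
proof (induction n)
  case 0
  show ?case by (auto intro!: computes.prim_0 computes.zero)
next
  case (Suc n)
  have "computes (Comp add_recf [Comp Succ [Proj 0], Proj 1]) [n, triangle n] (Suc n + triangle n)"
    by (rule computes_Comp2[OF _ _ computes_add])
       (auto intro!: computes_Comp1[of _ _ n] computes_Proj computes.succ)
  then show ?case using computes.prim_Suc[OF Suc] by (simp add: add.commute)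
qed

definition pair_recf :: recf where
  "pair_recf = Comp add_recf [Comp triangle_recf [add_recf], Proj 0]"

lemma computes_pair: "computes pair_recf [m, n] (prod_encode (m, n))"
proof -
  have "computes pair_recf [m, n] (triangle (m + n) + m)"
    unfolding pair_recf_def
    by (rule computes_Comp2[OF computes_Comp1[OF computes_add computes_triangle] _ computes_add])
       (simp add: computes_Proj)
  then show ?thesis by (simp add: prod_encode_def)
qed

definition computable :: "nat \<Rightarrow> (nat list \<Rightarrow> nat) \<Rightarrow> bool" where
  "computable k F \<longleftrightarrow> (\<exists>r. \<forall>xs. length xs = k \<longrightarrow> computes r xs (F xs))"

lemma computable_nth: "i < k \<Longrightarrow> computable k (\<lambda>xs. xs ! i)"
  unfolding computable_def by (intro exI[of _ "Proj i"]) (simp add: computes_Proj)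

lemma computable_Suc: "computable k F \<Longrightarrow> computable k (\<lambda>xs. Suc (F xs))"
  unfolding computable_def using computes_Comp1 computes.succ by blast

lemma computable_const: "computable k (\<lambda>_. c)"
proof (induction c)
  case 0
  show ?case unfolding computable_def using computes.zero by blast
qed (rule computable_Suc)

lemma computable_pair:
  "computable k F \<Longrightarrow> computable k G \<Longrightarrow> computable k (\<lambda>xs. prod_encode (F xs, G xs))"
  unfolding computable_def using computes_Comp2[OF _ _ computes_pair] by blast

definition is_zero_recf :: recf where
  "is_zero_recf = PrimRec (Comp Succ [Zero]) Zero"

lemma computes_is_zero: "computes is_zero_recf [n] (of_bool (n = 0))"
  unfolding is_zero_recf_def
proof (induction n)
  case 0
  show ?case
    using computes.prim_0[OF computes_Comp1[OF computes.zero computes.succ]] by simp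
next
  case (Suc n)
  then show ?case using computes.prim_Suc[OF Suc computes.zero] by simp
qed

text \<open>Minimizing a function that ignores the search variable stops at once or never.
  \<open>Minimize\<close> prepends that variable, hence the extra argument of \<open>T\<close> and
  the \<open>tl\<close>. Nothing is claimed for inputs on which \<open>f\<close> gives no 0/1
  answer.\<close>

lemma ex_recf_halting_iff_decided:
  assumes T: "\<And>xs. length xs = Suc k \<Longrightarrow> computes T xs (F (tl xs))"
  shows "\<exists>h. \<forall>xs b. length xs = k \<longrightarrow> computes f [F xs] (if b then 1 else 0) \<longrightarrow>
    (\<exists>y. computes h xs y) = b"
proof (intro exI allI impI)
  fix xs b assume len: "length xs = k" and f: "computes f [F xs] (if b then 1 else 0)"
  let ?g = "Comp is_zero_recf [Comp f [T]]"
  have g: "computes ?g (n # xs) (if b then 0 else 1)" for n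
  proof -
    have "computes T (n # xs) (F xs)" using T[of "n # xs"] len by simp
    from computes_Comp1[OF computes_Comp1[OF this f] computes_is_zero]
    show ?thesis by (simp split: if_splits)
  qed
  show "(\<exists>y. computes (Minimize ?g) xs y) = b"
  proof
    assume "\<exists>y. computes (Minimize ?g) xs y"
    then obtain y where "computes ?g (y # xs) 0" by (blast elim: computes_MinimizeE)
    then show b using g[of y] by (auto dest: computes_deterministic split: if_splits)
  next
    assume b
    then have "computes ?g (0 # xs) 0" using g[of 0] by simp
    then have "computes (Minimize ?g) xs 0" by (rule computes.minimize) simp
    then show "\<exists>y. computes (Minimize ?g) xs y" by blast
  qed
qed

text \<open>The input \<open>ns\<close> of the machine occurs in an instance only as an initial segment of one base
  vector; all other parts of its code are collected in \<open>ctx\<close>. Feeding \<open>ctx\<close> to the machine as its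
  own input replaces the recursion theorem.\<close>

definition cons_code :: "nat list \<Rightarrow> nat \<Rightarrow> nat" where
  "cons_code xs r = foldr (\<lambda>x r. Suc (prod_encode (x, r))) xs r"

text \<open>\<open>cons_code xs r\<close> codes a list that begins with \<open>xs\<close> and whose
  tail is known only through its code \<open>r\<close>; so the rest of the base vector can be
  supplied as a single number.\<close>

lemma list_encode_append: "list_encode (xs @ ys) = cons_code xs (list_encode ys)"
  by (induction xs) (simp_all add: cons_code_def)

definition reader_code :: "nat \<Rightarrow> nat \<Rightarrow> nat \<Rightarrow> nat \<Rightarrow> nat \<Rightarrow> nat" where
  "reader_code dim letters edges tgt s = cons_code [dim, list_encode [0, 1, 2], letters, s, edges,
     list_encode [2], tgt] 0"

definition instance_code :: "nat list \<Rightarrow> nat list \<Rightarrow> nat" where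
  "instance_code ctx ns =
     (let tgt = Suc (prod_encode (prod_encode (cons_code ns (ctx ! 0), ctx ! 1), ctx ! 2));
          code = reader_code (ctx ! 3) (ctx ! 4) (ctx ! 5) tgt
      in prod_encode (code 0, code 1))"

text \<open>The transitions of \<open>reader\<close> depend on \<open>d\<close> alone, so those of
  \<open>reader d 0 L\<close> serve both readers and every target.\<close>

definition context_of :: "nat \<Rightarrow> nat list \<Rightarrow> nat list list \<Rightarrow> (nat list \<times> nat list list) list \<Rightarrow> nat list" where
  "context_of d b ps L = [list_encode b, list_encode (map list_encode ps),
     list_encode (map encode_linear L), 2 * d, list_encode [0..<Suc d],
     list_encode (map encode_transition (desc_transitions (reader d 0 L)))]"

lemma encode_instance:
  "encode_pair (reader d 0 ((ns @ b, ps) # L), reader d 1 ((ns @ b, ps) # L)) =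
    instance_code (context_of d b ps L) ns"
  by (simp add: encode_pa_def reader_def instance_code_def reader_code_def context_of_def Let_def
      list_encode_append cons_code_def eval_nat_numeral)

text \<open>The arity 7 is the search variable plus the six entries of a context. Writing the input
  as a map over \<open>[0..<6]\<close> lets \<open>cons_code\<close> unfold into finitely many
  pairings of projections.\<close>

lemma computable_instance_code:
  "computable 7 (\<lambda>xs. instance_code (tl xs) (map ((!) (tl xs)) [0..<6]))"
proof -
  have "computable 7 (\<lambda>xs. instance_code (map (\<lambda>i. xs ! Suc i) [0..<6]) (map (\<lambda>i. xs ! Suc i) [0..<6]))"
    by (simp add: instance_code_def reader_code_def Let_def cons_code_def upt_rec)
       (intro computable_pair computable_Suc computable_const computable_nth; simp)
  moreover have "map (\<lambda>i. xs ! Suc i) [0..<6] = tl xs" if "length xs = 7" for xs :: "nat list"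
    using that by (intro nth_equalityI) (auto simp: nth_tl)
  moreover have "map ((!) (tl xs)) [0..<6] = tl xs" if "length xs = 7" for xs :: "nat list"
    using that by (intro nth_equalityI) auto
  ultimately show ?thesis unfolding computable_def by (metis (no_types, lifting))
qed

section \<open>The reduction and its self-application\<close>

lemma target_reader: "target (pa_of (reader d s (map (step_linear d) acts))) = (\<Union>a\<in>set acts. step_set d a)"
  by (auto simp: reader_simps step_set_def)

lemma step_linear_vectors:
  "(b, ps) = step_linear d a \<Longrightarrow> b \<in> vectors (2 * d) \<and> set ps \<subseteq> vectors (2 * d)"
  by (auto simp: step_linear_def vectors_def side_base_def side_period_def)

text \<open>Isolates the input: beyond the first \<open>length ns\<close> entries of the base,
  nothing depends on the values in \<open>ns\<close>.\<close>

lemma step_linear_init: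
  assumes "length ns \<le> N" "d = Suc (Suc N)"
  shows "step_linear d (init_action N ns) =
    (ns @ map (\<lambda>i. of_bool (i = N)) [length ns..<d] @ replicate d 0,
     map (\<lambda>k. map (\<lambda>i. of_bool (i = Suc N \<and> k = Suc N)) [0..<d] @ replicate d 0) [0..<d])"
proof -
  have "side_base d (init_side N ns) = ns @ map (\<lambda>i. of_bool (i = N)) [length ns..<d]"
    using assms by (intro nth_equalityI) (auto simp: side_base_def init_side_def nth_append)
  moreover have "side_period d k (init_side N ns) = map (\<lambda>i. of_bool (i = Suc N \<and> k = Suc N)) [0..<d]" for k
    using assms by (auto simp: side_period_def init_side_def)
  ultimately show ?thesis
    by (simp add: step_linear_def init_action_def)
       (auto simp: side_base_def side_period_def intro!: nth_equalityI)
qed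

text \<open>The context is fixed before the input and depends on \<open>h\<close> only, so the input
  may later be the context itself.\<close>

lemma halting_reduction:
  obtains ctx where "length ctx = 6"
    and "\<And>ns. length ns = 6 \<Longrightarrow> \<exists>D \<in> det_pa_pairs. encode_pair D = instance_code ctx ns \<and>
      ((case D of (D1, D2) \<Rightarrow> SR (pa_of D1) \<inter> SR (pa_of D2) \<noteq> {}) \<longleftrightarrow> (\<exists>y. computes h ns y))"
proof -
  have "set [0..<6] \<subseteq> {..<7::nat}" by auto
  \<comment> \<open>Inputs in registers 0 to 5, output in 6, scratch space from 7.\<close>
  then obtain R where R: "regular R" "implements R h [0..<6] 6 7"
    using recf_implementable[of h] by blast
  \<comment> \<open>Starting at 1 keeps all control states positive, which separates configurations
    from the zero vector.\<close>
  obtain T t where T: "program T 1 t R" using regular_program[OF R(1)] by blast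
  then have "finite T" unfolding program_def by blast
  then obtain es where es: "set es = T" using finite_list by blast
  obtain M where M: "\<forall>(p, a, q) \<in> T. act_bound M a" using T unfolding program_def by blast
  \<comment> \<open>At least 6, so that all input registers are among the coordinates.\<close>
  define N where "N = max M 6"
  have N: "\<forall>(p, a, q) \<in> set es. act_bound N a" "6 \<le> N"
    using M es act_bound_mono unfolding N_def by fastforce+
  define d where "d = Suc (Suc N)"
  define acts where "acts = halt_action N t # map (edge_action N) es"
  define L where "L = map (step_linear d) acts"
  define b where "b = map (\<lambda>i. of_bool (i = N)) [6..<d] @ replicate d (0::nat)"
  define ps where "ps = map (\<lambda>k. map (\<lambda>i. of_bool (i = Suc N \<and> k = Suc N)) [0..<d] @ replicate d (0::nat)) [0..<d]"
  show thesis
  proof (rule that)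
    show "length (context_of d b ps L) = 6" by (simp add: context_of_def)
    fix ns :: "nat list" assume ns: "length ns = 6"
    let ?L = "(ns @ b, ps) # L"
    have L: "?L = map (step_linear d) (init_action N ns # acts)"
      using step_linear_init[of ns N d] ns N(2) by (simp add: L_def d_def b_def ps_def)
    have valid: "(reader d 0 ?L, reader d 1 ?L) \<in> det_pa_pairs"
    proof -
      have "c \<in> vectors (2 * d) \<and> set qs \<subseteq> vectors (2 * d)" if "(c, qs) \<in> set ?L" for c qs
        using that step_linear_vectors unfolding L set_map by blast
      then have "valid_desc (reader d s ?L) \<and> deterministic (pa_of (reader d s ?L))" if "s \<le> 1" for s
        using reader_valid[of d s ?L] that by (simp add: d_def)
      from this[of 0] this[of 1] show ?thesis by (simp add: det_pa_pairs_def reader_simps)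
    qed
    have "SR (pa_of (reader d 0 ?L)) \<inter> SR (pa_of (reader d 1 ?L)) \<noteq> {} \<longleftrightarrow>
        (\<exists>\<tau>. (store_of (length ns) ns, \<tau>) \<in> R)"
      unfolding SR_reader_nonempty L target_reader acts_def d_def
      by (rule chain_iff) (use T es N ns in auto)
    also have "\<dots> \<longleftrightarrow> (\<exists>y. computes h ns y)"
    proof -
      have "map (store_of (length ns) ns) [0..<6] = ns"
        using ns by (intro nth_equalityI) (auto simp: store_of_def)
      then show ?thesis
        using implementsD(1,3)[OF R(2), of "store_of (length ns) ns"] by auto
    qed
    finally show "\<exists>D \<in> det_pa_pairs. encode_pair D = instance_code (context_of d b ps L) ns \<and>
      ((case D of (D1, D2) \<Rightarrow> SR (pa_of D1) \<inter> SR (pa_of D2) \<noteq> {}) \<longleftrightarrow> (\<exists>y. computes h ns y))"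
      using valid encode_instance by (intro bexI[OF _ valid]) simp
  qed
qed

theorem lemma42:
  shows "\<not> decidable_problem encode_pair det_pa_pairs
           (\<lambda>(D1, D2). SR (pa_of D1) \<inter> SR (pa_of D2) = {})"
proof
  assume "decidable_problem encode_pair det_pa_pairs (\<lambda>(D1, D2). SR (pa_of D1) \<inter> SR (pa_of D2) = {})"
  then obtain f where f: "\<And>D. D \<in> det_pa_pairs \<Longrightarrow> computes f [encode_pair D]
      (if case D of (D1, D2) \<Rightarrow> SR (pa_of D1) \<inter> SR (pa_of D2) = {} then 1 else 0)"
    unfolding decidable_problem_def by blast
  let ?F = "\<lambda>xs. instance_code xs (map ((!) xs) [0..<6])"
  obtain T where T: "\<And>xs. length xs = Suc 6 \<Longrightarrow> computes T xs (?F (tl xs))"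
    using computable_instance_code unfolding computable_def by auto
  from ex_recf_halting_iff_decided[where F = ?F and f = f, OF T] obtain h where h: "\<And>xs b. length xs = 6 \<Longrightarrow>
      computes f [?F xs] (if b then 1 else 0) \<Longrightarrow> (\<exists>y. computes h xs y) = b"
    by blast
  obtain ctx where ctx: "length ctx = 6"
    and red: "\<And>ns. length ns = 6 \<Longrightarrow> \<exists>D \<in> det_pa_pairs. encode_pair D = instance_code ctx ns \<and>
      ((case D of (D1, D2) \<Rightarrow> SR (pa_of D1) \<inter> SR (pa_of D2) \<noteq> {}) \<longleftrightarrow> (\<exists>y. computes h ns y))"
    using halting_reduction[of h] by blast
  \<comment> \<open>\<open>h\<close> is run on the context of its own machine: halting is equivalent
    to nonemptiness by the reduction and to emptiness by the choice of \<open>h\<close>.\<close>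
  obtain D where D: "D \<in> det_pa_pairs" "encode_pair D = instance_code ctx ctx"
    "(case D of (D1, D2) \<Rightarrow> SR (pa_of D1) \<inter> SR (pa_of D2) \<noteq> {}) \<longleftrightarrow> (\<exists>y. computes h ctx y)"
    using red[OF ctx] by blast
  have "map ((!) ctx) [0..<6] = ctx" using ctx by (intro nth_equalityI) auto
  then have "(\<exists>y. computes h ctx y) \<longleftrightarrow> (case D of (D1, D2) \<Rightarrow> SR (pa_of D1) \<inter> SR (pa_of D2) = {})"
    using h[OF ctx] f[OF D(1)] D(2) by simp
  then show False using D(3) by (cases D) simp
qed

end
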